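(* Let $M$ be a connected $C^3$-smooth compact $n$-dimensional manifold without boundary. Let $H:\mathbb{R}\times T^*M\to\mathbb{R}$ and $L:\mathbb{R}\times TM\to\mathbb{R}$ be $C^2$-smooth functions that are fiberwise Fenchel (Legendre) transforms of each other, and assume $H(t+1,q,p)=H(t,q,p)$ for all $(t,q,p)\in\mathbb{R}\times T^*M$. Consider the following conditions, each required in any local coordinates $(q_1,\dots,q_n)$ of $M$, with constants depending on the local coordinates. (A) There exist constants $0<C_1<C_2$ such that $C_1|u|^2\le\sum_{i,j}\frac{\partial^2H}{\partial p_i\partial p_j}(t,q,p)u_iu_j\le C_2|u|^2$ for all $u\in\mathbb{R}^n$ (and all $(t,q,p)$ in the chart). (B) With these constants, $\bigl|\frac{\partial^2H}{\partial q_i\partial p_j}(t,q,p)\bigr|\le C_2(1+|p|)$ and $\bigl|\frac{\partial^2H}{\partial q_i\partial q_j}(t,q,p)\bigr|\le C_2(1+|p|^2)$. (C) There exist constants $0<c<C$ such that $\sum_{i,j}\frac{\partial^2L}{\partial v_i\partial v_j}(t,q,v)u_iu_j\ge c|u|^2$ for all $u\in\mathbb{R}^n$. (D) With these constants, $\bigl|\frac{\partial^2L}{\partial q_i\partial q_j}(t,q,v)\bigr|\le C(1+|v|^2)$, $\bigl|\frac{\partial^2L}{\partial q_i\partial v_j}(t,q,v)\bigr|\le C(1+|v|)$ and $\bigl|\frac{\partial^2L}{\partial v_i\partial v_j}(t,q,v)\bigr|\le C$. Then (A) is equivalent to (C) together with the third inequality in (D); and (A) together with (B) is equivalent to (C)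 together with (D).
   Context: Local coordinates $(q_1,\dots,q_n)$ on $M$ induce coordinates $(q,v)$ on $TM$ and $(q,p)$ on $T^*M$. That $H$ and $L$ are fiberwise Fenchel (Legendre) transforms of each other means: the map $(t,q,p)\mapsto(t,q,D_pH(t,q,p))$ is a fiber-preserving $C^1$-diffeomorphism $\mathbb{R}/\mathbb{Z}\times T^*M\to\mathbb{R}/\mathbb{Z}\times TM$ with inverse $(t,q,v)\mapsto(t,q,D_vL(t,q,v))$; $L(t,q,v)=\max_{p\in T_q^*M}\{\langle p,v\rangle-H(t,q,p)\}=\langle p(t,q,v),v\rangle-H(t,q,p(t,q,v))$, where $p(t,q,v)$ is the unique point with $v=D_pH(t,q,p)$; and $H(t,q,p)=\langle p,v(t,q,p)\rangle-L(t,q,v(t,q,p))$, where $v(t,q,p)$ is the unique point with $p=D_vL(t,q,v)$. *)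

theory Defs
  imports "HOL-Analysis.Analysis"
begin

section \<open>Functions of class C^k\<close>

text \<open>Meant for open \<open>S\<close> in a finite-dimensional space, where continuity of all iterated directional
  derivatives of a differentiable function is continuity of the iterated total derivatives.\<close>

primrec Ck_on :: "nat \<Rightarrow> 'a::euclidean_space set \<Rightarrow> ('a \<Rightarrow> 'b::real_normed_vector) \<Rightarrow> bool" where
  "Ck_on 0 S f \<longleftrightarrow> continuous_on S f"
| "Ck_on (Suc k) S f \<longleftrightarrow>
     (\<forall>x\<in>S. f differentiable (at x)) \<and> (\<forall>v. Ck_on k S (\<lambda>x. frechet_derivative f (at x) v))"

definition pderiv_at :: "'n \<Rightarrow> (real ^ 'n \<Rightarrow> real) \<Rightarrow> real ^ 'n \<Rightarrow> real" where
  "pderiv_at i f x = deriv (\<lambda>s. f (x + s *\<^sub>R axis i 1)) 0"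


section \<open>Manifolds of class C^k\<close>

text \<open>A chart is its domain together with the coordinate map; the values of the coordinate map
  outside the domain are irrelevant.\<close>

type_synonym ('a, 'n) chart = "'a set \<times> ('a \<Rightarrow> real ^ 'n)"

definition is_chart :: "'a topology \<Rightarrow> ('a, 'n::finite) chart \<Rightarrow> bool" where
  "is_chart M c \<longleftrightarrow> openin M (fst c) \<and> open (snd c ` fst c) \<and>
     homeomorphic_map (subtopology M (fst c)) (top_of_set (snd c ` fst c)) (snd c)"

definition chart_inv :: "('a, 'n) chart \<Rightarrow> real ^ 'n \<Rightarrow> 'a" where
  "chart_inv c = inv_into (fst c) (snd c)"

definition transition :: "('a, 'n) chart \<Rightarrow> ('a, 'n) chart \<Rightarrow> real ^ 'n \<Rightarrow> real ^ 'n" where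
  "transition c d = snd d \<circ> chart_inv c"

definition compatible :: "nat \<Rightarrow> ('a, 'n::finite) chart \<Rightarrow> ('a, 'n) chart \<Rightarrow> bool" where
  "compatible k c d \<longleftrightarrow>
     Ck_on k (snd c ` (fst c \<inter> fst d)) (transition c d) \<and>
     Ck_on k (snd d ` (fst c \<inter> fst d)) (transition d c)"

text \<open>The atlas \<open>\<A>\<close> is maximal, so its members are exactly the local coordinates of the manifold.\<close>

definition Ck_manifold :: "nat \<Rightarrow> 'a topology \<Rightarrow> ('a, 'n::finite) chart set \<Rightarrow> bool" where
  "Ck_manifold k M \<A> \<longleftrightarrow>
     Hausdorff_space M \<and> second_countable M \<and>
     (\<forall>c\<in>\<A>. is_chart M c) \<and>
     (\<Union>c\<in>\<A>. fst c) = topspace M \<and>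
     (\<forall>c\<in>\<A>. \<forall>d\<in>\<A>. compatible k c d) \<and>
     (\<forall>c. is_chart M c \<and> (\<forall>d\<in>\<A>. compatible k c d) \<longrightarrow> c \<in> \<A>)"


section \<open>Tangent and cotangent bundle\<close>

text \<open>A tangent vector at \<open>q\<close> is the family of its coordinate vectors in all charts around \<open>q\<close>,
  related by the derivatives of the coordinate changes; the value 0 at the other
  indices makes the representation unique, and the vector space operations are pointwise.\<close>

type_synonym ('a, 'n) tvec = "('a, 'n) chart \<Rightarrow> real ^ 'n"
type_synonym ('a, 'n) covec = "('a, 'n) tvec \<Rightarrow> real"

definition charts_at :: "('a, 'n) chart set \<Rightarrow> 'a \<Rightarrow> ('a, 'n) chart set" where
  "charts_at \<A> q = {c \<in> \<A>. q \<in> fst c}"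

definition tangent_space :: "('a, 'n::finite) chart set \<Rightarrow> 'a \<Rightarrow> ('a, 'n) tvec set" where
  "tangent_space \<A> q = {\<xi>.
     (\<forall>c. c \<notin> charts_at \<A> q \<longrightarrow> \<xi> c = 0) \<and>
     (\<forall>c\<in>charts_at \<A> q. \<forall>d\<in>charts_at \<A> q.
        \<xi> d = frechet_derivative (transition c d) (at (snd c q)) (\<xi> c))}"

text \<open>The linear functionals on the tangent space, set to 0 outside of it.\<close>

definition cotangent_space :: "('a, 'n::finite) chart set \<Rightarrow> 'a \<Rightarrow> ('a, 'n) covec set" where
  "cotangent_space \<A> q = {\<alpha>.
     (\<forall>\<xi>. \<xi> \<notin> tangent_space \<A> q \<longrightarrow> \<alpha> \<xi> = 0) \<and>
     (\<forall>\<xi>\<in>tangent_space \<A> q. \<forall>\<eta>\<in>tangent_space \<A> q. \<forall>a b.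
        \<alpha> (\<lambda>c. a *\<^sub>R \<xi> c + b *\<^sub>R \<eta> c) = a * \<alpha> \<xi> + b * \<alpha> \<eta>)}"

definition TM :: "'a topology \<Rightarrow> ('a, 'n::finite) chart set \<Rightarrow> ('a \<times> ('a, 'n) tvec) set" where
  "TM M \<A> = Sigma (topspace M) (tangent_space \<A>)"

definition coTM :: "'a topology \<Rightarrow> ('a, 'n::finite) chart set \<Rightarrow> ('a \<times> ('a, 'n) covec) set" where
  "coTM M \<A> = Sigma (topspace M) (cotangent_space \<A>)"

text \<open>\<open>tvec_of \<A> c q v\<close> is the tangent vector \<open>\<Sum>i. v\<^sub>i \<partial>/\<partial>q\<^sub>i\<close> and
  \<open>covec_of \<A> c q p\<close> the covector \<open>\<Sum>i. p\<^sub>i dq\<^sub>i\<close> in the coordinates \<open>c\<close> around \<open>q\<close>.\<close>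

definition tvec_of ::
  "('a, 'n::finite) chart set \<Rightarrow> ('a, 'n) chart \<Rightarrow> 'a \<Rightarrow> real ^ 'n \<Rightarrow> ('a, 'n) tvec" where
  "tvec_of \<A> c q v =
     (\<lambda>d. if d \<in> charts_at \<A> q then frechet_derivative (transition c d) (at (snd c q)) v else 0)"

definition covec_of ::
  "('a, 'n::finite) chart set \<Rightarrow> ('a, 'n) chart \<Rightarrow> 'a \<Rightarrow> real ^ 'n \<Rightarrow> ('a, 'n) covec" where
  "covec_of \<A> c q p = (\<lambda>\<xi>. if \<xi> \<in> tangent_space \<A> q then p \<bullet> \<xi> c else 0)"

text \<open>The coordinates \<open>(q,v)\<close> on the tangent bundle and \<open>(q,p)\<close> on the cotangent bundle induced by
  a chart, and the corresponding parametrizations.\<close>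

definition tangent_coords :: "('a, 'n) chart \<Rightarrow> 'a \<times> ('a, 'n) tvec \<Rightarrow> (real ^ 'n) \<times> (real ^ 'n)" where
  "tangent_coords c = (\<lambda>(q, \<xi>). (snd c q, \<xi> c))"

definition cotangent_coords ::
  "('a, 'n::finite) chart set \<Rightarrow> ('a, 'n) chart \<Rightarrow> 'a \<times> ('a, 'n) covec \<Rightarrow> (real ^ 'n) \<times> (real ^ 'n)" where
  "cotangent_coords \<A> c = (\<lambda>(q, \<alpha>). (snd c q, \<chi> i. \<alpha> (tvec_of \<A> c q (axis i 1))))"

definition tangent_param ::
  "('a, 'n::finite) chart set \<Rightarrow> ('a, 'n) chart \<Rightarrow> (real ^ 'n) \<times> (real ^ 'n) \<Rightarrow> 'a \<times> ('a, 'n) tvec" where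
  "tangent_param \<A> c = (\<lambda>(x, v). (chart_inv c x, tvec_of \<A> c (chart_inv c x) v))"

definition cotangent_param ::
  "('a, 'n::finite) chart set \<Rightarrow> ('a, 'n) chart \<Rightarrow> (real ^ 'n) \<times> (real ^ 'n) \<Rightarrow> 'a \<times> ('a, 'n) covec" where
  "cotangent_param \<A> c = (\<lambda>(x, p). (chart_inv c x, covec_of \<A> c (chart_inv c x) p))"

definition coord_domain :: "('a, 'n) chart \<Rightarrow> (real \<times> (real ^ 'n) \<times> (real ^ 'n)) set" where
  "coord_domain c = UNIV \<times> (snd c ` fst c) \<times> UNIV"


section \<open>Hamiltonians and Lagrangians\<close>

text \<open>Time-dependent functions on the (co)tangent bundle are total functions of which only the
  values on \<open>coTM M \<A>\<close>, resp. \<open>TM M \<A>\<close>, matter.\<close>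

type_synonym ('a, 'n) hamiltonian = "real \<Rightarrow> 'a \<times> ('a, 'n) covec \<Rightarrow> real"
type_synonym ('a, 'n) lagrangian = "real \<Rightarrow> 'a \<times> ('a, 'n) tvec \<Rightarrow> real"

definition H_loc :: "('a, 'n::finite) chart set \<Rightarrow> ('a, 'n) chart \<Rightarrow> ('a, 'n) hamiltonian \<Rightarrow>
    real \<Rightarrow> real ^ 'n \<Rightarrow> real ^ 'n \<Rightarrow> real" where
  "H_loc \<A> c H t x p = H t (cotangent_param \<A> c (x, p))"

definition L_loc :: "('a, 'n::finite) chart set \<Rightarrow> ('a, 'n) chart \<Rightarrow> ('a, 'n) lagrangian \<Rightarrow>
    real \<Rightarrow> real ^ 'n \<Rightarrow> real ^ 'n \<Rightarrow> real" where
  "L_loc \<A> c L t x v = L t (tangent_param \<A> c (x, v))"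

definition Ck_hamiltonian ::
  "nat \<Rightarrow> ('a, 'n::finite) chart set \<Rightarrow> ('a, 'n) hamiltonian \<Rightarrow> bool" where
  "Ck_hamiltonian k \<A> H \<longleftrightarrow> (\<forall>c\<in>\<A>. Ck_on k (coord_domain c) (\<lambda>(t, x, p). H_loc \<A> c H t x p))"

definition Ck_lagrangian ::
  "nat \<Rightarrow> ('a, 'n::finite) chart set \<Rightarrow> ('a, 'n) lagrangian \<Rightarrow> bool" where
  "Ck_lagrangian k \<A> L \<longleftrightarrow> (\<forall>c\<in>\<A>. Ck_on k (coord_domain c) (\<lambda>(t, x, v). L_loc \<A> c L t x v))"


section \<open>Fiberwise Legendre duality\<close>

text \<open>The fiber derivative of \<open>L\<close> is a covector. That of \<open>H\<close> is a linear functional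
  on the cotangent space, identified with the tangent vector representing it.\<close>

definition DvL :: "('a, 'n::finite) chart set \<Rightarrow> ('a, 'n) lagrangian \<Rightarrow>
    real \<Rightarrow> 'a \<Rightarrow> ('a, 'n) tvec \<Rightarrow> ('a, 'n) covec" where
  "DvL \<A> L t q \<xi> =
     (\<lambda>\<eta>. if \<eta> \<in> tangent_space \<A> q then deriv (\<lambda>s. L t (q, \<lambda>c. \<xi> c + s *\<^sub>R \<eta> c)) 0 else 0)"

definition DpH :: "('a, 'n::finite) chart set \<Rightarrow> ('a, 'n) hamiltonian \<Rightarrow>
    real \<Rightarrow> 'a \<Rightarrow> ('a, 'n) covec \<Rightarrow> ('a, 'n) tvec" where
  "DpH \<A> H t q \<alpha> = (THE \<xi>. \<xi> \<in> tangent_space \<A> q \<and>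
     (\<forall>\<beta>\<in>cotangent_space \<A> q.
        ((\<lambda>s. H t (q, \<lambda>\<eta>. \<alpha> \<eta> + s * \<beta> \<eta>)) has_real_derivative \<beta> \<xi>) (at 0)))"

definition legendre_H :: "('a, 'n::finite) chart set \<Rightarrow> ('a, 'n) hamiltonian \<Rightarrow>
    real \<times> 'a \<times> ('a, 'n) covec \<Rightarrow> real \<times> 'a \<times> ('a, 'n) tvec" where
  "legendre_H \<A> H = (\<lambda>(t, q, \<alpha>). (t, q, DpH \<A> H t q \<alpha>))"

definition legendre_L :: "('a, 'n::finite) chart set \<Rightarrow> ('a, 'n) lagrangian \<Rightarrow>
    real \<times> 'a \<times> ('a, 'n) tvec \<Rightarrow> real \<times> 'a \<times> ('a, 'n) covec" where
  "legendre_L \<A> L = (\<lambda>(t, q, \<xi>). (t, q, DvL \<A> L t q \<xi>))"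

text \<open>The first clause expresses the C^1-diffeomorphism over the universal cover \<open>\<real>\<close> of the time
  circle; both maps fix \<open>t\<close>, so when \<open>H\<close> is 1-periodic they descend to \<open>\<real>/\<int>\<close>, and the
  quotient maps are inverse C^1-diffeomorphisms iff these are. Since both maps also fix the base
  point, it is enough to test smoothness with the same chart of \<open>M\<close> on both sides.\<close>

definition legendre_diffeo :: "'a topology \<Rightarrow> ('a, 'n::finite) chart set \<Rightarrow>
    ('a, 'n) hamiltonian \<Rightarrow> ('a, 'n) lagrangian \<Rightarrow> bool" where
  "legendre_diffeo M \<A> H L \<longleftrightarrow>
     bij_betw (legendre_H \<A> H) (UNIV \<times> coTM M \<A>) (UNIV \<times> TM M \<A>) \<and>
     bij_betw (legendre_L \<A> L) (UNIV \<times> TM M \<A>) (UNIV \<times> coTM M \<A>) \<and>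
     (\<forall>z\<in>UNIV \<times> coTM M \<A>. legendre_L \<A> L (legendre_H \<A> H z) = z) \<and>
     (\<forall>w\<in>UNIV \<times> TM M \<A>. legendre_H \<A> H (legendre_L \<A> L w) = w) \<and>
     (\<forall>c\<in>\<A>.
        Ck_on 1 (coord_domain c)
          (\<lambda>(t, y). map_prod id (tangent_coords c) (legendre_H \<A> H (t, cotangent_param \<A> c y))) \<and>
        Ck_on 1 (coord_domain c)
          (\<lambda>(t, y). map_prod id (cotangent_coords \<A> c) (legendre_L \<A> L (t, tangent_param \<A> c y))))"

text \<open>In the second and third clause, \<open>\<alpha>\<close> and \<open>\<xi>\<close> as described exist and are unique
  by the first one.\<close>

definition fiberwise_legendre_dual :: "'a topology \<Rightarrow> ('a, 'n::finite) chart set \<Rightarrow>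
    ('a, 'n) hamiltonian \<Rightarrow> ('a, 'n) lagrangian \<Rightarrow> bool" where
  "fiberwise_legendre_dual M \<A> H L \<longleftrightarrow>
     legendre_diffeo M \<A> H L \<and>
     (\<forall>t. \<forall>q\<in>topspace M. \<forall>\<xi>\<in>tangent_space \<A> q. \<forall>\<alpha>\<in>cotangent_space \<A> q.
        \<xi> = DpH \<A> H t q \<alpha> \<longrightarrow>
          L t (q, \<xi>) = \<alpha> \<xi> - H t (q, \<alpha>) \<and>
          (\<forall>\<beta>\<in>cotangent_space \<A> q. \<beta> \<xi> - H t (q, \<beta>) \<le> L t (q, \<xi>))) \<and>
     (\<forall>t. \<forall>q\<in>topspace M. \<forall>\<alpha>\<in>cotangent_space \<A> q. \<forall>\<xi>\<in>tangent_space \<A> q.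
        \<alpha> = DvL \<A> L t q \<xi> \<longrightarrow> H t (q, \<alpha>) = \<alpha> \<xi> - L t (q, \<xi>))"


section \<open>Growth conditions in local coordinates\<close>

definition d2_fiber_fiber :: "'n \<Rightarrow> 'n \<Rightarrow> (real ^ 'n \<Rightarrow> real ^ 'n \<Rightarrow> real) \<Rightarrow> real ^ 'n \<Rightarrow> real ^ 'n \<Rightarrow> real" where
  "d2_fiber_fiber i j F x p = pderiv_at i (\<lambda>p'. pderiv_at j (F x) p') p"

definition d2_base_fiber :: "'n \<Rightarrow> 'n \<Rightarrow> (real ^ 'n \<Rightarrow> real ^ 'n \<Rightarrow> real) \<Rightarrow> real ^ 'n \<Rightarrow> real ^ 'n \<Rightarrow> real" where
  "d2_base_fiber i j F x p = pderiv_at i (\<lambda>x'. pderiv_at j (F x') p) x"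

definition d2_base_base :: "'n \<Rightarrow> 'n \<Rightarrow> (real ^ 'n \<Rightarrow> real ^ 'n \<Rightarrow> real) \<Rightarrow> real ^ 'n \<Rightarrow> real ^ 'n \<Rightarrow> real" where
  "d2_base_base i j F x p = pderiv_at i (\<lambda>x'. pderiv_at j (\<lambda>x''. F x'' p) x') x"

definition cond_A :: "('a, 'n::finite) chart set \<Rightarrow> ('a, 'n) hamiltonian \<Rightarrow> ('a, 'n) chart \<Rightarrow>
    real \<Rightarrow> real \<Rightarrow> bool" where
  "cond_A \<A> H c C1 C2 \<longleftrightarrow> (\<forall>t. \<forall>x\<in>snd c ` fst c. \<forall>p u.
     C1 * (norm u)\<^sup>2 \<le> (\<Sum>i\<in>UNIV. \<Sum>j\<in>UNIV. d2_fiber_fiber i j (H_loc \<A> c H t) x p * u $ i * u $ j) \<and>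
     (\<Sum>i\<in>UNIV. \<Sum>j\<in>UNIV. d2_fiber_fiber i j (H_loc \<A> c H t) x p * u $ i * u $ j) \<le> C2 * (norm u)\<^sup>2)"

definition cond_B :: "('a, 'n::finite) chart set \<Rightarrow> ('a, 'n) hamiltonian \<Rightarrow> ('a, 'n) chart \<Rightarrow>
    real \<Rightarrow> bool" where
  "cond_B \<A> H c C2 \<longleftrightarrow> (\<forall>t. \<forall>x\<in>snd c ` fst c. \<forall>p i j.
     \<bar>d2_base_fiber i j (H_loc \<A> c H t) x p\<bar> \<le> C2 * (1 + norm p) \<and>
     \<bar>d2_base_base i j (H_loc \<A> c H t) x p\<bar> \<le> C2 * (1 + (norm p)\<^sup>2))"

definition cond_C :: "('a, 'n::finite) chart set \<Rightarrow> ('a, 'n) lagrangian \<Rightarrow> ('a, 'n) chart \<Rightarrow>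
    real \<Rightarrow> bool" where
  "cond_C \<A> L c c0 \<longleftrightarrow> (\<forall>t. \<forall>x\<in>snd c ` fst c. \<forall>v u.
     (\<Sum>i\<in>UNIV. \<Sum>j\<in>UNIV. d2_fiber_fiber i j (L_loc \<A> c L t) x v * u $ i * u $ j) \<ge> c0 * (norm u)\<^sup>2)"

definition cond_D_qq_qv :: "('a, 'n::finite) chart set \<Rightarrow> ('a, 'n) lagrangian \<Rightarrow> ('a, 'n) chart \<Rightarrow>
    real \<Rightarrow> bool" where
  "cond_D_qq_qv \<A> L c C0 \<longleftrightarrow> (\<forall>t. \<forall>x\<in>snd c ` fst c. \<forall>v i j.
     \<bar>d2_base_base i j (L_loc \<A> c L t) x v\<bar> \<le> C0 * (1 + (norm v)\<^sup>2) \<and>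
     \<bar>d2_base_fiber i j (L_loc \<A> c L t) x v\<bar> \<le> C0 * (1 + norm v))"

definition cond_D_vv :: "('a, 'n::finite) chart set \<Rightarrow> ('a, 'n) lagrangian \<Rightarrow> ('a, 'n) chart \<Rightarrow>
    real \<Rightarrow> bool" where
  "cond_D_vv \<A> L c C0 \<longleftrightarrow> (\<forall>t. \<forall>x\<in>snd c ` fst c. \<forall>v i j.
     \<bar>d2_fiber_fiber i j (L_loc \<A> c L t) x v\<bar> \<le> C0)"

text \<open>The conditions are imposed in every coordinate system of a family \<open>\<C>\<close> of local coordinates,
  with constants depending on the coordinate system. For \<open>\<C>\<close> the whole maximal atlas,
  \<open>holds_A\<close> and \<open>holds_C_Dvv\<close> are satisfied by no \<open>H\<close>, \<open>L\<close> on a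
  nonempty manifold (distorting coordinates by an unbounded factor destroys every uniform bound). Hence the parameter \<open>\<C>\<close>, which may be
  the whole atlas, but also the relatively compact charts, a finite atlas, or a single chart.\<close>

definition holds_A :: "('a, 'n::finite) chart set \<Rightarrow> ('a, 'n) chart set \<Rightarrow>
    ('a, 'n) hamiltonian \<Rightarrow> bool" where
  "holds_A \<A> \<C> H \<longleftrightarrow> (\<forall>c\<in>\<C>. \<exists>C1 C2. 0 < C1 \<and> C1 < C2 \<and> cond_A \<A> H c C1 C2)"

definition holds_AB :: "('a, 'n::finite) chart set \<Rightarrow> ('a, 'n) chart set \<Rightarrow>
    ('a, 'n) hamiltonian \<Rightarrow> bool" where
  "holds_AB \<A> \<C> H \<longleftrightarrow>
     (\<forall>c\<in>\<C>. \<exists>C1 C2. 0 < C1 \<and> C1 < C2 \<and> cond_A \<A> H c C1 C2 \<and> cond_B \<A> H c C2)"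

definition holds_C_Dvv :: "('a, 'n::finite) chart set \<Rightarrow> ('a, 'n) chart set \<Rightarrow>
    ('a, 'n) lagrangian \<Rightarrow> bool" where
  "holds_C_Dvv \<A> \<C> L \<longleftrightarrow>
     (\<forall>c\<in>\<C>. \<exists>c0 C0. 0 < c0 \<and> c0 < C0 \<and> cond_C \<A> L c c0 \<and> cond_D_vv \<A> L c C0)"

definition holds_CD :: "('a, 'n::finite) chart set \<Rightarrow> ('a, 'n) chart set \<Rightarrow>
    ('a, 'n) lagrangian \<Rightarrow> bool" where
  "holds_CD \<A> \<C> L \<longleftrightarrow>
     (\<forall>c\<in>\<C>. \<exists>c0 C0. 0 < c0 \<and> c0 < C0 \<and>
        cond_C \<A> L c c0 \<and> cond_D_qq_qv \<A> L c C0 \<and> cond_D_vv \<A> L c C0)"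

end

theory Submission
  imports Defs
begin

text \<open>
  Fix a chart and a time. The Hamiltonian and the Lagrangian become functions \<open>h(x,p)\<close> and \<open>l(x,v)\<close>
  with \<open>h(x,p) + l(x,v) - p \<bullet> v \<ge> 0\<close>, where for every \<open>p\<close> there is a \<open>v\<close>, and for every \<open>v\<close> a \<open>p\<close>,
  giving equality. At such a minimum all first derivatives vanish (\<open>young_equality\<close>): with
  \<open>p = D\<^sub>v l(x,v)\<close> one has \<open>D\<^sub>p h(x,p) = v\<close> and \<open>D\<^sub>x l(x,v) = - D\<^sub>x h(x,p)\<close>. Differentiating these
  identities once more expresses the second derivatives of \<open>l\<close> through those of \<open>h\<close>; writing
  \<open>l\<^sub>v\<^sub>x\<close> for the derivative of \<open>D\<^sub>v l\<close> along \<open>x\<close>, and so on,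
  \<open>l\<^sub>v\<^sub>v\<close> is the inverse of \<open>h\<^sub>p\<^sub>p\<close>, \<open>l\<^sub>v\<^sub>x = - l\<^sub>v\<^sub>v h\<^sub>p\<^sub>x\<close>, and \<open>l\<^sub>x\<^sub>x = - h\<^sub>x\<^sub>x - h\<^sub>x\<^sub>p l\<^sub>v\<^sub>x\<close>. The bounds on the fiber
  Hessian transfer at once, because a coercive bounded matrix has a coercive bounded inverse.

  The other bounds are stated for \<open>h\<close> in terms of \<open>|p|\<close> and for \<open>l\<close> in terms of \<open>|v|\<close>, so their transfer
  needs \<open>|p| = O(1 + |v|)\<close>, uniformly over the chart. No property of the chart gives this: its image
  may be unbounded or have infinitely many components. It comes from the fact that
  \<open>H(t,q,0) + L(t,q,0)\<close> is a continuous function on the compact manifold, periodic in time, hence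
  bounded by some \<open>K\<close> independent of coordinates (\<open>zero_section_sum_bounded\<close>). By strong convexity
  \<open>K \<ge> h(x,0) + l(x,0) \<ge> h(x,0) - h(x,p) \<ge> c/2 |p|\<^sup>2 - p \<bullet> v\<close>, which is the required growth
  (\<open>legendre_growth\<close>).

  Since the situation is symmetric in \<open>h\<close> and \<open>l\<close>, only the transfer from \<open>h\<close> to \<open>l\<close> has to be proved
  (\<open>fiber_bounds_dual\<close>, \<open>base_bounds_dual\<close>). Symmetry of second derivatives is used twice: to bound
  single entries of the fiber Hessian by its quadratic form, and to bound \<open>h\<^sub>x\<^sub>p\<close>, given a
  bound on \<open>h\<^sub>p\<^sub>x\<close>.
\<close>

section \<open>Second derivatives of C^2 functions\<close>

lemma Ck_on_2_iff:
  "Ck_on 2 S f \<longleftrightarrow> (\<forall>x\<in>S. f differentiable (at x)) \<and>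
     (\<forall>v. \<forall>x\<in>S. (\<lambda>x. frechet_derivative f (at x) v) differentiable (at x)) \<and>
     (\<forall>v w. continuous_on S (\<lambda>x. frechet_derivative (\<lambda>x. frechet_derivative f (at x) v) (at x) w))"
  by (auto simp: numeral_2_eq_2)

lemma frechet_derivative_eq_on_open:
  assumes "open S" "z \<in> S" "\<And>x. x \<in> S \<Longrightarrow> f x = g x" "f differentiable (at z)"
  shows "g differentiable (at z)" "frechet_derivative g (at z) = frechet_derivative f (at z)"
proof -
  have "(f has_derivative frechet_derivative f (at z)) (at z)"
    using assms(4) frechet_derivative_works by blast
  then have "(g has_derivative frechet_derivative f (at z)) (at z)"
    using has_derivative_transform_within_open assms(1-3) by blast
  then show "g differentiable (at z)" "frechet_derivative g (at z) = frechet_derivative f (at z)"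
    by (auto simp: differentiable_def dest: frechet_derivative_at[symmetric])
qed

text \<open>The class \<open>C\<^sup>k\<close> is defined through the operator \<open>frechet_derivative\<close> at points of \<open>S\<close>,
  and on an open set two functions that agree have the same derivatives.\<close>

lemma Ck_on_cong:
  assumes "open S" "\<And>x. x \<in> S \<Longrightarrow> f x = g x" "Ck_on k S f"
  shows "Ck_on k S g"
  using assms(2,3)
proof (induction k arbitrary: f g)
  case 0
  have "continuous_on S f \<longleftrightarrow> continuous_on S g"
    by (rule continuous_on_cong[OF refl 0(1)])
  then show ?case using 0(2) by (simp only: Ck_on.simps)
next
  case (Suc k)
  have eq: "g differentiable (at z)" "frechet_derivative g (at z) = frechet_derivative f (at z)"
    if "z \<in> S" for z
    using Suc.prems(2) frechet_derivative_eq_on_open[OF assms(1) that, of f g] Suc.prems(1) that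
    by (simp_all only: Ck_on.simps)
  have "Ck_on k S (\<lambda>x. frechet_derivative g (at x) v)" for v
  proof (rule Suc.IH)
    show "Ck_on k S (\<lambda>x. frechet_derivative f (at x) v)" using Suc.prems(2) by simp
  qed (simp only: eq)
  then show ?case using eq(1) by simp
qed

lemma has_derivative_slice:
  assumes "f differentiable (at (t, z))"
  shows "((\<lambda>z. f (t, z)) has_derivative (\<lambda>w. frechet_derivative f (at (t, z)) (0, w))) (at z)"
proof -
  have "((\<lambda>z. (t, z)) has_derivative (\<lambda>w. (0, w))) (at z)"
    by (auto intro!: derivative_eq_intros)
  from has_derivative_compose[OF this] show ?thesis
    using assms frechet_derivative_works by blast
qed

text \<open>Freezing the first variable of a \<open>C\<^sup>k\<close> function; this is how time is removed from the problem.\<close>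

lemma Ck_on_slice:
  fixes f :: "'a::euclidean_space \<times> 'b::euclidean_space \<Rightarrow> 'c::real_normed_vector"
  assumes "open S" "Ck_on k S f"
  shows "Ck_on k {z. (t, z) \<in> S} (\<lambda>z. f (t, z))"
  using assms(2)
proof (induction k arbitrary: f)
  case 0
  have "continuous_on {z. (t, z) \<in> S} (f \<circ> Pair t)"
    by (rule continuous_on_compose)
      (use 0 in \<open>auto intro!: continuous_intros elim: continuous_on_subset\<close>)
  then show ?case by (simp add: o_def)
next
  case (Suc k)
  have "{z. (t, z) \<in> S} = Pair t -` S" by auto
  then have op: "open {z. (t, z) \<in> S}"
    using assms(1) by (simp add: open_vimage continuous_on_Pair)
  have hd: "((\<lambda>z. f (t, z)) has_derivative (\<lambda>w. frechet_derivative f (at (t, z)) (0, w))) (at z)"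
    if "(t, z) \<in> S" for z
    using that Suc.prems by (intro has_derivative_slice) auto
  have "Ck_on k {z. (t, z) \<in> S} (\<lambda>z. frechet_derivative (\<lambda>z. f (t, z)) (at z) v)" for v
  proof (rule Ck_on_cong[OF op])
    show "frechet_derivative f (at (t, z)) (0, v) = frechet_derivative (\<lambda>z. f (t, z)) (at z) v"
      if "z \<in> {z. (t, z) \<in> S}" for z
      using that hd frechet_derivative_at by (metis mem_Collect_eq)
    show "Ck_on k {z. (t, z) \<in> S} (\<lambda>z. frechet_derivative f (at (t, z)) (0, v))"
      using Suc.prems by (intro Suc.IH[of "\<lambda>z. frechet_derivative f (at z) (0, v)"]) auto
  qed
  moreover have "(\<lambda>z. f (t, z)) differentiable (at z)" if "(t, z) \<in> S" for z
    using hd[OF that] by (rule differentiableI)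
  ultimately show ?case by simp
qed

lemma has_real_derivative_along_line:
  fixes f :: "'a::real_normed_vector \<Rightarrow> real"
  assumes "f differentiable (at (z + s *\<^sub>R v))"
  shows "((\<lambda>s. f (z + s *\<^sub>R v)) has_real_derivative frechet_derivative f (at (z + s *\<^sub>R v)) v) (at s)"
proof -
  have f: "(f has_derivative frechet_derivative f (at (z + s *\<^sub>R v))) (at (z + s *\<^sub>R v))"
    using assms frechet_derivative_works by blast
  have "((\<lambda>s. z + s *\<^sub>R v) has_derivative (\<lambda>a. a *\<^sub>R v)) (at s)"
    by (auto intro!: derivative_eq_intros)
  from has_derivative_compose[OF this f]
  have "((\<lambda>s. f (z + s *\<^sub>R v)) has_derivative
      (\<lambda>a. frechet_derivative f (at (z + s *\<^sub>R v)) (a *\<^sub>R v))) (at s)" .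
  moreover have "frechet_derivative f (at (z + s *\<^sub>R v)) (a *\<^sub>R v) =
      frechet_derivative f (at (z + s *\<^sub>R v)) v * a" for a
    using linear_scale[OF has_derivative_linear[OF f]] by simp
  ultimately show ?thesis by (simp add: has_field_derivative_def)
qed

text \<open>Two applications of the mean value theorem: the second difference over the parallelogram spanned
  by \<open>s v\<close> and \<open>s w\<close> equals \<open>s\<^sup>2\<close> times the iterated derivative at some point of the
  parallelogram, which shrinks to \<open>z\<close>. The derivative in direction \<open>w\<close> of the derivative in direction
  \<open>v\<close> thus becomes the limit of an expression that is symmetric in \<open>v\<close> and \<open>w\<close>.\<close>

lemma second_difference_limit:
  fixes f :: "'a::euclidean_space \<Rightarrow> real"
  assumes "open S" "Ck_on 2 S f" "z \<in> S"
  shows "((\<lambda>s. (f (z + s *\<^sub>R v + s *\<^sub>R w) - f (z + s *\<^sub>R v) - f (z + s *\<^sub>R w) + f z) / s\<^sup>2)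
     \<longlongrightarrow> frechet_derivative (\<lambda>x. frechet_derivative f (at x) v) (at z) w) (at_right 0)"
    (is "(?\<Delta> \<longlongrightarrow> ?g z) _")
proof (rule tendstoI)
  fix e :: real assume "e > 0"
  have diff: "f differentiable (at x)" "(\<lambda>x. frechet_derivative f (at x) v) differentiable (at x)"
    if "x \<in> S" for x
    using assms(2) that by (auto simp: Ck_on_2_iff)
  have "isCont ?g z"
    using assms by (simp add: Ck_on_2_iff continuous_on_eq_continuous_at)
  then obtain d1 where d1: "d1 > 0" "\<And>y. dist y z < d1 \<Longrightarrow> dist (?g y) (?g z) < e"
    using \<open>e > 0\<close> unfolding continuous_at_eps_delta by blast
  obtain d2 where d2: "d2 > 0" "ball z d2 \<subseteq> S"
    using assms(1,3) openE by blast
  define d where "d = min d1 d2"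
  \<comment> \<open>Chosen such that the parallelogram with sides \<open>s v\<close>, \<open>s w\<close> lies in \<open>ball z d\<close> for \<open>s < \<delta>\<close>; the summand 1 avoids a zero denominator.\<close>
  define \<delta> where "\<delta> = d / (norm v + norm w + 1)"
  have pos: "norm v + norm w + 1 > 0" by (simp add: add_nonneg_pos)
  have "d > 0" using d1 d2 by (simp add: d_def)
  then have "\<delta> > 0" using pos by (simp add: \<delta>_def)
  have "dist (?\<Delta> s) (?g z) < e" if s: "0 < s" "s < \<delta>" for s
  proof -
    have near: "dist (z + a *\<^sub>R v + b *\<^sub>R w) z < d" if "0 \<le> a" "a \<le> s" "0 \<le> b" "b \<le> s" for a b
    proof -
      have "dist (z + a *\<^sub>R v + b *\<^sub>R w) z \<le> norm (a *\<^sub>R v) + norm (b *\<^sub>R w)"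
        by (simp add: dist_norm norm_triangle_ineq add.assoc del: norm_scaleR)
      also have "\<dots> \<le> s * norm v + s * norm w"
        using that by (intro add_mono) (auto intro: mult_right_mono)
      also have "\<dots> \<le> s * (norm v + norm w + 1)" using s by (simp add: algebra_simps)
      also have "\<dots> < \<delta> * (norm v + norm w + 1)" using s pos by (intro mult_strict_right_mono)
      also have "\<dots> = d" using pos by (simp add: \<delta>_def)
      finally show ?thesis .
    qed
    then have inS: "z + a *\<^sub>R v + b *\<^sub>R w \<in> S" if "0 \<le> a" "a \<le> s" "0 \<le> b" "b \<le> s" for a b
      using that d2(2) unfolding d_def by (fastforce simp: dist_commute)
    have "\<exists>\<theta>>0. \<theta> < s \<and>
        (f (z + s *\<^sub>R v + s *\<^sub>R w) - f (z + s *\<^sub>R v)) - (f (z + 0 *\<^sub>R v + s *\<^sub>R w) - f (z + 0 *\<^sub>R v)) =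
        (s - 0) * (frechet_derivative f (at (z + \<theta> *\<^sub>R v + s *\<^sub>R w)) v -
          frechet_derivative f (at (z + \<theta> *\<^sub>R v)) v)"
    proof (rule MVT2[OF s(1)])
      fix a assume a: "0 \<le> a" "a \<le> s"
      have "((\<lambda>a. f ((z + s *\<^sub>R w) + a *\<^sub>R v)) has_real_derivative
          frechet_derivative f (at ((z + s *\<^sub>R w) + a *\<^sub>R v)) v) (at a)"
        using inS[of a s] a s by (intro has_real_derivative_along_line diff) (simp add: algebra_simps)
      moreover have "((\<lambda>a. f (z + a *\<^sub>R v)) has_real_derivative
          frechet_derivative f (at (z + a *\<^sub>R v)) v) (at a)"
        using inS[of a 0] a s by (intro has_real_derivative_along_line diff) simp
      ultimately show "((\<lambda>a. f (z + a *\<^sub>R v + s *\<^sub>R w) - f (z + a *\<^sub>R v)) has_real_derivative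
          frechet_derivative f (at (z + a *\<^sub>R v + s *\<^sub>R w)) v -
          frechet_derivative f (at (z + a *\<^sub>R v)) v) (at a)"
        by (auto intro!: DERIV_diff simp: add.assoc add.commute[of "_ *\<^sub>R w"])
    qed
    then obtain \<theta> where \<theta>: "0 < \<theta>" "\<theta> < s"
      "f (z + s *\<^sub>R v + s *\<^sub>R w) - f (z + s *\<^sub>R v) - f (z + s *\<^sub>R w) + f z =
        s * (frechet_derivative f (at (z + \<theta> *\<^sub>R v + s *\<^sub>R w)) v -
          frechet_derivative f (at (z + \<theta> *\<^sub>R v)) v)"
      by (force simp: algebra_simps)
    have "\<exists>\<eta>>0. \<eta> < s \<and>
        frechet_derivative f (at (z + \<theta> *\<^sub>R v + s *\<^sub>R w)) v -
        frechet_derivative f (at (z + \<theta> *\<^sub>R v + 0 *\<^sub>R w)) v = (s - 0) * ?g (z + \<theta> *\<^sub>R v + \<eta> *\<^sub>R w)"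
    proof (rule MVT2[OF s(1)])
      fix b assume "0 \<le> b" "b \<le> s"
      then show "((\<lambda>b. frechet_derivative f (at (z + \<theta> *\<^sub>R v + b *\<^sub>R w)) v) has_real_derivative
          ?g (z + \<theta> *\<^sub>R v + b *\<^sub>R w)) (at b)"
        using inS[of \<theta> b] \<theta>
        by (intro has_real_derivative_along_line[of "\<lambda>x. frechet_derivative f (at x) v"] diff) simp
    qed
    then obtain \<eta> where \<eta>: "0 < \<eta>" "\<eta> < s"
      "frechet_derivative f (at (z + \<theta> *\<^sub>R v + s *\<^sub>R w)) v - frechet_derivative f (at (z + \<theta> *\<^sub>R v)) v
        = s * ?g (z + \<theta> *\<^sub>R v + \<eta> *\<^sub>R w)"
      by auto
    have "?\<Delta> s = ?g (z + \<theta> *\<^sub>R v + \<eta> *\<^sub>R w)"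
      using s by (simp add: \<theta>(3) \<eta>(3) power2_eq_square)
    moreover have "dist (z + \<theta> *\<^sub>R v + \<eta> *\<^sub>R w) z < d1"
      using near[of \<theta> \<eta>] \<theta> \<eta> by (simp add: d_def)
    ultimately show ?thesis using d1(2) by simp
  qed
  then show "\<forall>\<^sub>F s in at_right 0. dist (?\<Delta> s) (?g z) < e"
    using \<open>\<delta> > 0\<close> by (auto simp: eventually_at_right_field)
qed

theorem second_derivative_symmetric:
  fixes f :: "'a::euclidean_space \<Rightarrow> real"
  assumes "open S" "Ck_on 2 S f" "z \<in> S"
  shows "frechet_derivative (\<lambda>x. frechet_derivative f (at x) v) (at z) w =
    frechet_derivative (\<lambda>x. frechet_derivative f (at x) w) (at z) v"
proof -
  let ?\<Delta> = "\<lambda>v w s. (f (z + s *\<^sub>R v + s *\<^sub>R w) - f (z + s *\<^sub>R v) - f (z + s *\<^sub>R w) + f z) / s\<^sup>2"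
  have "?\<Delta> v w = ?\<Delta> w v" by (auto simp: algebra_simps)
  with second_difference_limit[OF assms, of w v]
  have "(?\<Delta> v w \<longlongrightarrow> frechet_derivative (\<lambda>x. frechet_derivative f (at x) w) (at z) v) (at_right 0)"
    by simp
  with second_difference_limit[OF assms, of v w] show ?thesis
    by (intro tendsto_unique[of "at_right (0::real)"]) simp_all
qed

section \<open>Functions of class C^2 on a product of base and fiber\<close>

lemma pderiv_at_eq:
  assumes "f differentiable (at x)"
  shows "pderiv_at i f x = frechet_derivative f (at x) (axis i 1)"
  unfolding pderiv_at_def
  using has_real_derivative_along_line[of f x 0 "axis i 1"] assms by (simp add: DERIV_imp_deriv)

lemma pderiv_at_has_derivative:
  assumes "(f has_derivative f') (at x)"
  shows "pderiv_at i f x = f' (axis i 1)"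
  using pderiv_at_eq[of f x i] assms differentiableI frechet_derivative_at by metis

lemma linear_axis_expansion:
  fixes f :: "real ^ 'n \<Rightarrow> real"
  assumes "linear f"
  shows "f a = (\<Sum>i\<in>UNIV. a $ i * f (axis i 1))"
proof -
  have "f (\<Sum>i\<in>UNIV. a $ i *\<^sub>R axis i 1) = (\<Sum>i\<in>UNIV. a $ i * f (axis i 1))"
    using assms by (simp add: linear_sum linear_scale)
  moreover have "(\<Sum>i\<in>UNIV. a $ i *\<^sub>R axis i 1) = a"
    using basis_expansion[of a] by (simp only: scalar_mult_eq_scaleR)
  ultimately show ?thesis by simp
qed

text \<open>The second derivatives of the growth conditions are partial derivatives of one block of variables
  at a time; these lemmas convert them into total derivatives, to which the chain rule applies.\<close>

lemma pderiv_at_slices: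
  fixes G :: "(real ^ 'n) \<times> (real ^ 'm) \<Rightarrow> real"
  assumes "G differentiable (at (x, p))"
  shows "pderiv_at i (\<lambda>x'. G (x', p)) x = frechet_derivative G (at (x, p)) (axis i 1, 0)"
    and "pderiv_at j (\<lambda>p'. G (x, p')) p = frechet_derivative G (at (x, p)) (0, axis j 1)"
proof -
  have G: "(G has_derivative frechet_derivative G (at (x, p))) (at (x, p))"
    using assms frechet_derivative_works by blast
  have "((\<lambda>x'. (x', p)) has_derivative (\<lambda>a. (a, 0))) (at x)"
    by (auto intro!: derivative_eq_intros)
  from pderiv_at_has_derivative[OF has_derivative_compose[OF this G]]
  show "pderiv_at i (\<lambda>x'. G (x', p)) x = frechet_derivative G (at (x, p)) (axis i 1, 0)" .
  from pderiv_at_has_derivative[OF has_derivative_slice[OF assms]]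
  show "pderiv_at j (\<lambda>p'. G (x, p')) p = frechet_derivative G (at (x, p)) (0, axis j 1)" .
qed

lemma has_derivative_pderiv_at:
  fixes G :: "(real ^ 'n) \<times> (real ^ 'm) \<Rightarrow> real"
  assumes "G differentiable (at (x, p))"
  shows "(G has_derivative (\<lambda>(a, b).
      (\<Sum>i\<in>UNIV. a $ i * pderiv_at i (\<lambda>x'. G (x', p)) x) +
      (\<Sum>j\<in>UNIV. b $ j * pderiv_at j (\<lambda>p'. G (x, p')) p))) (at (x, p))"
proof -
  let ?D = "frechet_derivative G (at (x, p))"
  have G: "(G has_derivative ?D) (at (x, p))"
    using assms frechet_derivative_works by blast
  then have lin: "linear ?D" by (rule has_derivative_linear)
  have eq: "?D (a, b) = (\<Sum>i\<in>UNIV. a $ i * ?D (axis i 1, 0)) + (\<Sum>j\<in>UNIV. b $ j * ?D (0, axis j 1))" for a b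
  proof -
    have "linear (\<lambda>a::real ^ 'n. (a, 0::real ^ 'm))" "linear (\<lambda>b::real ^ 'm. (0::real ^ 'n, b))"
      by (rule linearI; simp)+
    then have 1: "linear (\<lambda>a. ?D (a, 0))" "linear (\<lambda>b. ?D (0, b))"
      using linear_compose[OF _ lin] unfolding o_def by blast+
    have "?D (a, b) = ?D (a, 0) + ?D (0, b)"
      using linear_add[OF lin, of "(a, 0)" "(0, b)"] by simp
    then show ?thesis
      using linear_axis_expansion[OF 1(1), of a] linear_axis_expansion[OF 1(2), of b] by simp
  qed
  have "?D = (\<lambda>(a, b).
      (\<Sum>i\<in>UNIV. a $ i * pderiv_at i (\<lambda>x'. G (x', p)) x) +
      (\<Sum>j\<in>UNIV. b $ j * pderiv_at j (\<lambda>p'. G (x, p')) p))"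
  proof (rule ext)
    fix w :: "(real ^ 'n) \<times> (real ^ 'm)"
    show "?D w = (case w of (a, b) \<Rightarrow>
        (\<Sum>i\<in>UNIV. a $ i * pderiv_at i (\<lambda>x'. G (x', p)) x) +
        (\<Sum>j\<in>UNIV. b $ j * pderiv_at j (\<lambda>p'. G (x, p')) p))"
      by (cases w) (simp only: prod.case pderiv_at_slices[OF assms] eq[symmetric])
  qed
  with G show ?thesis by simp
qed

lemma has_derivative_vec:
  fixes f :: "'a::real_normed_vector \<Rightarrow> real ^ 'n"
  assumes "\<And>j. ((\<lambda>z. f z $ j) has_derivative (\<lambda>w. f' w $ j)) (at z)"
  shows "(f has_derivative f') (at z)"
proof (subst has_derivative_componentwise_within, intro ballI)
  fix b :: "real ^ 'n" assume "b \<in> Basis"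
  then obtain j where "b = axis j 1" by (auto simp: Basis_vec_def)
  then show "((\<lambda>x. f x \<bullet> b) has_derivative (\<lambda>x. f' x \<bullet> b)) (at z)"
    using assms[of j] by (simp add: inner_axis)
qed

lemma sum_axis_mult: "(\<Sum>i\<in>UNIV. axis k (1::real) $ i * m i) = m k"
  by (simp add: axis_def if_distrib if_distribR cong: if_cong)

text \<open>Block form of the first and second derivatives of \<open>F(x,p)\<close>, written as linear maps so that
  chain-rule identities need no matrix products. In \<open>mixed_hess\<close> the fiber gradient is
  differentiated along the base; \<open>mixed_hess_transpose\<close> has the transposed coefficients and will turn
  out to be the derivative of the base gradient along the fiber.\<close>

definition base_grad :: "(real ^ 'n \<Rightarrow> real ^ 'n \<Rightarrow> real) \<Rightarrow> real ^ 'n \<Rightarrow> real ^ 'n \<Rightarrow> real ^ 'n" where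
  "base_grad F x p = (\<chi> j. pderiv_at j (\<lambda>x'. F x' p) x)"

definition fiber_grad :: "(real ^ 'n \<Rightarrow> real ^ 'n \<Rightarrow> real) \<Rightarrow> real ^ 'n \<Rightarrow> real ^ 'n \<Rightarrow> real ^ 'n" where
  "fiber_grad F x p = (\<chi> j. pderiv_at j (F x) p)"

definition base_hess :: "(real ^ 'n \<Rightarrow> real ^ 'n \<Rightarrow> real) \<Rightarrow> real ^ 'n \<Rightarrow> real ^ 'n \<Rightarrow> real ^ 'n \<Rightarrow> real ^ 'n" where
  "base_hess F x p a = (\<chi> j. \<Sum>i\<in>UNIV. a $ i * d2_base_base i j F x p)"

definition fiber_hess :: "(real ^ 'n \<Rightarrow> real ^ 'n \<Rightarrow> real) \<Rightarrow> real ^ 'n \<Rightarrow> real ^ 'n \<Rightarrow> real ^ 'n \<Rightarrow> real ^ 'n" where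
  "fiber_hess F x p b = (\<chi> j. \<Sum>i\<in>UNIV. b $ i * d2_fiber_fiber i j F x p)"

definition mixed_hess :: "(real ^ 'n \<Rightarrow> real ^ 'n \<Rightarrow> real) \<Rightarrow> real ^ 'n \<Rightarrow> real ^ 'n \<Rightarrow> real ^ 'n \<Rightarrow> real ^ 'n" where
  "mixed_hess F x p a = (\<chi> j. \<Sum>i\<in>UNIV. a $ i * d2_base_fiber i j F x p)"

definition mixed_hess_transpose :: "(real ^ 'n \<Rightarrow> real ^ 'n \<Rightarrow> real) \<Rightarrow> real ^ 'n \<Rightarrow> real ^ 'n \<Rightarrow> real ^ 'n \<Rightarrow> real ^ 'n" where
  "mixed_hess_transpose F x p b = (\<chi> j. \<Sum>i\<in>UNIV. b $ i * d2_base_fiber j i F x p)"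

lemma d2_eq_pderiv_grad:
  "d2_fiber_fiber i j F x p = pderiv_at i (\<lambda>p'. fiber_grad F x p' $ j) p"
  "d2_base_fiber i j F x p = pderiv_at i (\<lambda>x'. fiber_grad F x' p $ j) x"
  "d2_base_base i j F x p = pderiv_at i (\<lambda>x'. base_grad F x' p $ j) x"
  by (simp_all add: d2_fiber_fiber_def d2_base_fiber_def d2_base_base_def base_grad_def fiber_grad_def)

lemma quadratic_form_eq:
  "(\<Sum>i\<in>UNIV. \<Sum>j\<in>UNIV. d2_fiber_fiber i j F x p * u $ i * u $ j) = u \<bullet> fiber_hess F x p u"
proof -
  have "u \<bullet> fiber_hess F x p u = (\<Sum>j\<in>UNIV. \<Sum>i\<in>UNIV. d2_fiber_fiber i j F x p * u $ i * u $ j)"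
    by (simp add: inner_vec_def fiber_hess_def sum_distrib_left algebra_simps)
  also have "\<dots> = (\<Sum>i\<in>UNIV. \<Sum>j\<in>UNIV. d2_fiber_fiber i j F x p * u $ i * u $ j)"
    by (rule sum.swap)
  finally show ?thesis by (rule sym)
qed

locale C2_fibered =
  fixes U :: "(real ^ 'n) set" and F :: "real ^ 'n \<Rightarrow> real ^ 'n \<Rightarrow> real"
  assumes open_base: "open U" and C2: "Ck_on 2 (U \<times> UNIV) (\<lambda>(x, p). F x p)"
begin

lemma open_domain: "open (U \<times> (UNIV :: (real ^ 'n) set))"
  using open_base by (intro open_Times) auto

abbreviation F' where "F' z \<equiv> frechet_derivative (\<lambda>(x, p). F x p) (at z)"

lemma grad_component:
  assumes "x \<in> U"
  shows "base_grad F x p $ j = F' (x, p) (axis j 1, 0)"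
    and "fiber_grad F x p $ j = F' (x, p) (0, axis j 1)"
proof -
  have "(\<lambda>(x, p). F x p) differentiable (at (x, p))"
    using C2 assms unfolding Ck_on_2_iff by blast
  from pderiv_at_slices[OF this]
  show "base_grad F x p $ j = F' (x, p) (axis j 1, 0)"
    "fiber_grad F x p $ j = F' (x, p) (0, axis j 1)"
    by (simp_all add: base_grad_def fiber_grad_def)
qed

lemma has_derivative_joint:
  assumes "x \<in> U"
  shows "((\<lambda>(x, p). F x p) has_derivative
    (\<lambda>(a, b). a \<bullet> base_grad F x p + b \<bullet> fiber_grad F x p)) (at (x, p))"
proof -
  have "(\<lambda>(x, p). F x p) differentiable (at (x, p))"
    using C2 assms unfolding Ck_on_2_iff by blast
  from has_derivative_pderiv_at[OF this] show ?thesis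
    by (simp add: inner_vec_def base_grad_def fiber_grad_def)
qed

lemma grad_differentiable:
  assumes "x \<in> U"
  shows "(\<lambda>(x, p). base_grad F x p $ j) differentiable (at (x, p))"
    and "frechet_derivative (\<lambda>(x, p). base_grad F x p $ j) (at (x, p)) =
      frechet_derivative (\<lambda>z. F' z (axis j 1, 0)) (at (x, p))"
    and "(\<lambda>(x, p). fiber_grad F x p $ j) differentiable (at (x, p))"
    and "frechet_derivative (\<lambda>(x, p). fiber_grad F x p $ j) (at (x, p)) =
      frechet_derivative (\<lambda>z. F' z (0, axis j 1)) (at (x, p))"
proof -
  have diff: "(\<lambda>z. F' z v) differentiable (at (x, p))" for v
    using C2 assms unfolding Ck_on_2_iff by blast
  have mem: "(x, p) \<in> U \<times> UNIV" using assms by simp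
  have eq: "F' z (axis j 1, 0) = (\<lambda>(x, p). base_grad F x p $ j) z"
    "F' z (0, axis j 1) = (\<lambda>(x, p). fiber_grad F x p $ j) z" if "z \<in> U \<times> UNIV" for z
    using that by (auto simp: grad_component)
  note b = frechet_derivative_eq_on_open[of _ _ "\<lambda>z. F' z (axis j 1, 0)"
      "\<lambda>(x, p). base_grad F x p $ j", OF open_domain mem eq(1) diff]
  note f = frechet_derivative_eq_on_open[of _ _ "\<lambda>z. F' z (0, axis j 1)"
      "\<lambda>(x, p). fiber_grad F x p $ j", OF open_domain mem eq(2) diff]
  show "(\<lambda>(x, p). base_grad F x p $ j) differentiable (at (x, p))"
    and "frechet_derivative (\<lambda>(x, p). base_grad F x p $ j) (at (x, p)) =
      frechet_derivative (\<lambda>z. F' z (axis j 1, 0)) (at (x, p))"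
    and "(\<lambda>(x, p). fiber_grad F x p $ j) differentiable (at (x, p))"
    and "frechet_derivative (\<lambda>(x, p). fiber_grad F x p $ j) (at (x, p)) =
      frechet_derivative (\<lambda>z. F' z (0, axis j 1)) (at (x, p))"
    using b f by blast+
qed

lemma d2_eq_second_derivative:
  assumes "x \<in> U"
  shows "d2_fiber_fiber i j F x p = frechet_derivative (\<lambda>z. F' z (0, axis j 1)) (at (x, p)) (0, axis i 1)"
    and "d2_base_fiber i j F x p = frechet_derivative (\<lambda>z. F' z (0, axis j 1)) (at (x, p)) (axis i 1, 0)"
    and "pderiv_at i (\<lambda>p'. base_grad F x p' $ j) p =
      frechet_derivative (\<lambda>z. F' z (axis j 1, 0)) (at (x, p)) (0, axis i 1)"
  using pderiv_at_slices[OF grad_differentiable(1)[OF assms], of i j p]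
    pderiv_at_slices[OF grad_differentiable(3)[OF assms], of i j p]
  by (simp_all add: grad_differentiable(2,4)[OF assms] d2_eq_pderiv_grad)

lemma d2_fiber_fiber_symmetric:
  assumes "x \<in> U"
  shows "d2_fiber_fiber i j F x p = d2_fiber_fiber j i F x p"
  using second_derivative_symmetric[OF open_domain C2] assms
  by (simp add: d2_eq_second_derivative)

text \<open>This exchange of derivatives is what makes a bound on \<open>d2_base_fiber\<close> control also the derivative
  of the base gradient along the fiber.\<close>

lemma pderiv_base_grad:
  assumes "x \<in> U"
  shows "pderiv_at i (\<lambda>p'. base_grad F x p' $ j) p = d2_base_fiber j i F x p"
  using second_derivative_symmetric[OF open_domain C2] assms
  by (simp add: d2_eq_second_derivative)

lemma has_derivative_fiber_grad:
  assumes "x \<in> U"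
  shows "((\<lambda>(x, p). fiber_grad F x p) has_derivative
    (\<lambda>(a, b). mixed_hess F x p a + fiber_hess F x p b)) (at (x, p))"
proof (rule has_derivative_vec)
  fix j
  show "((\<lambda>z. (case z of (x, p) \<Rightarrow> fiber_grad F x p) $ j) has_derivative
      (\<lambda>w. (case w of (a, b) \<Rightarrow> mixed_hess F x p a + fiber_hess F x p b) $ j)) (at (x, p))"
    using has_derivative_pderiv_at[OF grad_differentiable(3)[OF assms], of j p]
    by (simp add: case_prod_unfold mixed_hess_def fiber_hess_def d2_eq_pderiv_grad)
qed

lemma has_derivative_base_grad:
  assumes "x \<in> U"
  shows "((\<lambda>(x, p). base_grad F x p) has_derivative
    (\<lambda>(a, b). base_hess F x p a + mixed_hess_transpose F x p b)) (at (x, p))"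
proof (rule has_derivative_vec)
  fix j
  show "((\<lambda>z. (case z of (x, p) \<Rightarrow> base_grad F x p) $ j) has_derivative
      (\<lambda>w. (case w of (a, b) \<Rightarrow> base_hess F x p a + mixed_hess_transpose F x p b) $ j)) (at (x, p))"
    using has_derivative_pderiv_at[OF grad_differentiable(1)[OF assms], of j p]
    by (simp add: pderiv_base_grad[OF assms] case_prod_unfold base_hess_def
        mixed_hess_transpose_def d2_eq_pderiv_grad(3))
qed

lemma fiber_grad_has_derivative_fiber:
  assumes "x \<in> U"
  shows "(fiber_grad F x has_derivative fiber_hess F x p) (at p)"
proof -
  have "((\<lambda>p. (x, p)) has_derivative (\<lambda>b. (0, b))) (at p)"
    by (auto intro!: derivative_eq_intros)
  from has_derivative_compose[OF this has_derivative_fiber_grad[OF assms]] show ?thesis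
    by (simp add: mixed_hess_def flip: zero_vec_def)
qed

lemma has_derivative_fiber:
  assumes "x \<in> U"
  shows "(F x has_derivative (\<lambda>b. b \<bullet> fiber_grad F x p)) (at p)"
proof -
  have "((\<lambda>p. (x, p)) has_derivative (\<lambda>b. (0, b))) (at p)"
    by (auto intro!: derivative_eq_intros)
  from has_derivative_compose[OF this has_derivative_joint[OF assms]] show ?thesis by simp
qed

lemma has_derivative_base:
  assumes "x \<in> U"
  shows "((\<lambda>x. F x p) has_derivative (\<lambda>a. a \<bullet> base_grad F x p)) (at x)"
proof -
  have "((\<lambda>x. (x, p)) has_derivative (\<lambda>a. (a, 0))) (at x)"
    by (auto intro!: derivative_eq_intros)
  from has_derivative_compose[OF this has_derivative_joint[OF assms]] show ?thesis by simp
qed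

lemma grad_has_derivative_base:
  assumes "x \<in> U"
  shows "((\<lambda>x. fiber_grad F x p) has_derivative mixed_hess F x p) (at x)"
    and "((\<lambda>x. base_grad F x p) has_derivative base_hess F x p) (at x)"
proof -
  have "((\<lambda>x. (x, p)) has_derivative (\<lambda>a. (a, 0))) (at x)"
    by (auto intro!: derivative_eq_intros)
  from has_derivative_compose[OF this has_derivative_fiber_grad[OF assms]]
    has_derivative_compose[OF this has_derivative_base_grad[OF assms]]
  show "((\<lambda>x. fiber_grad F x p) has_derivative mixed_hess F x p) (at x)"
    and "((\<lambda>x. base_grad F x p) has_derivative base_hess F x p) (at x)"
    by (simp_all add: fiber_hess_def mixed_hess_transpose_def flip: zero_vec_def)
qed

lemma fiber_hess_linear: "x \<in> U \<Longrightarrow> linear (fiber_hess F x p)"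
  using fiber_grad_has_derivative_fiber has_derivative_linear by blast

text \<open>By polarization, \<open>4 A\<^sub>i\<^sub>j\<close> is the difference of the values of the quadratic form at
  \<open>e\<^sub>i + e\<^sub>j\<close> and \<open>e\<^sub>i - e\<^sub>j\<close>, both of which lie between 0 and \<open>4 C\<close>. Since a quadratic form
  sees only the symmetric part of a matrix, the symmetry of the Hessian is essential.\<close>

lemma d2_fiber_fiber_le_of_quadratic_form:
  assumes "x \<in> U" and lower: "\<And>u. 0 \<le> u \<bullet> fiber_hess F x p u"
    and upper: "\<And>u. u \<bullet> fiber_hess F x p u \<le> C * (norm u)\<^sup>2"
  shows "\<bar>d2_fiber_fiber i j F x p\<bar> \<le> C"
proof -
  let ?A = "fiber_hess F x p" and ?e = "\<lambda>i. axis i 1 :: real ^ 'n"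
  note lin = fiber_hess_linear[OF assms(1)]
  have entry: "?e l \<bullet> ?A (?e k) = d2_fiber_fiber k l F x p" for k l
    by (simp add: inner_axis' fiber_hess_def sum_axis_mult)
  have sym: "?e i \<bullet> ?A (?e j) = ?e j \<bullet> ?A (?e i)"
    using d2_fiber_fiber_symmetric[OF assms(1)] by (simp only: entry)
  have polarization: "(?e i + ?e j) \<bullet> ?A (?e i + ?e j) - (?e i - ?e j) \<bullet> ?A (?e i - ?e j) =
      4 * d2_fiber_fiber i j F x p"
    unfolding entry[symmetric] linear_add[OF lin] linear_diff[OF lin] using sym
    by (simp add: algebra_simps)
  have "C \<ge> 0" using order_trans[OF lower[of "?e i"] upper[of "?e i"]] by simp
  have bound: "0 \<le> u \<bullet> ?A u \<and> u \<bullet> ?A u \<le> C * 4" if "norm u \<le> 2" for u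
  proof -
    have "(norm u)\<^sup>2 \<le> 2\<^sup>2" using that by (intro power_mono) auto
    then have "C * (norm u)\<^sup>2 \<le> C * 4" using \<open>C \<ge> 0\<close> by (intro mult_left_mono) auto
    then show ?thesis using lower[of u] upper[of u] by simp
  qed
  have "norm (?e i + ?e j) \<le> 2" "norm (?e i - ?e j) \<le> 2"
    using norm_triangle_ineq[of "?e i" "?e j"] norm_triangle_ineq4[of "?e i" "?e j"] by simp_all
  from bound[OF this(1)] bound[OF this(2)] polarization show ?thesis by linarith
qed

lemma fiber_strongly_convex:
  assumes "x \<in> U" and lower: "\<And>p u. c * (norm u)\<^sup>2 \<le> u \<bullet> fiber_hess F x p u"
  shows "F x p + (q - p) \<bullet> fiber_grad F x p + c / 2 * (norm (q - p))\<^sup>2 \<le> F x q"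
proof -
  let ?w = "q - p"
  \<comment> \<open>The derivatives of order 0, 1, 2 of \<open>F x\<close> along the segment from \<open>p\<close> to \<open>q\<close>, in the form expected by Taylor's theorem.\<close>
  let ?f = "\<lambda>(m::nat) s. (if m = 0 then F x (p + s *\<^sub>R ?w) else if m = 1 then ?w \<bullet> fiber_grad F x (p + s *\<^sub>R ?w)
      else ?w \<bullet> fiber_hess F x (p + s *\<^sub>R ?w) ?w) :: real"
  have line: "((\<lambda>s. p + s *\<^sub>R ?w) has_derivative (\<lambda>a. a *\<^sub>R ?w)) (at s)" for s
    by (auto intro!: derivative_eq_intros)
  have 0: "((\<lambda>s. F x (p + s *\<^sub>R ?w)) has_real_derivative ?w \<bullet> fiber_grad F x (p + s *\<^sub>R ?w)) (at s)" for s
    using has_derivative_compose[OF line has_derivative_fiber[OF assms(1)], of s]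
    by (simp add: has_field_derivative_def mult_commute_abs)
  have 1: "((\<lambda>s. ?w \<bullet> fiber_grad F x (p + s *\<^sub>R ?w)) has_real_derivative
      ?w \<bullet> fiber_hess F x (p + s *\<^sub>R ?w) ?w) (at s)" for s
  proof -
    have lin: "linear (fiber_hess F x (p + s *\<^sub>R ?w))"
      using fiber_grad_has_derivative_fiber[OF assms(1)] has_derivative_linear by blast
    have "((\<lambda>s. ?w \<bullet> fiber_grad F x (p + s *\<^sub>R ?w)) has_derivative
        (\<lambda>a. ?w \<bullet> fiber_hess F x (p + s *\<^sub>R ?w) (a *\<^sub>R ?w))) (at s)"
      by (intro has_derivative_inner_right
          has_derivative_compose[OF line fiber_grad_has_derivative_fiber[OF assms(1)]])
    then show ?thesis
      by (simp only: linear_scale[OF lin] has_field_derivative_def inner_scaleR_right mult_commute_abs)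
  qed
  have "\<exists>t::real. 0 < t \<and> t < 1 \<and>
    ?f 0 1 = (\<Sum>m<2. (?f m 0 / fact m) * (1 - 0)^m) + (?f 2 t / fact 2) * (1 - 0)^2"
  proof (rule Taylor_up[where a = 0])
    show "\<forall>m t. m < 2 \<and> 0 \<le> t \<and> t \<le> 1 \<longrightarrow> (?f m has_real_derivative ?f (Suc m) t) (at t)"
      using 0 1 by (auto simp: less_2_cases_iff)
  qed auto
  then obtain t where "F x q = F x p + ?w \<bullet> fiber_grad F x p + (?w \<bullet> fiber_hess F x (p + t *\<^sub>R ?w) ?w) / 2"
    by (auto simp: numeral_2_eq_2)
  then show ?thesis using lower[of ?w "p + t *\<^sub>R ?w"] by simp
qed

end

section \<open>Fenchel pairs\<close>

lemma gradient_zero_at_min: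
  fixes f :: "'a::euclidean_space \<Rightarrow> real"
  assumes "(f has_derivative (\<lambda>a. a \<bullet> g)) (at x)" "open S" "x \<in> S" "\<And>y. y \<in> S \<Longrightarrow> f x \<le> f y"
  shows "g = 0"
proof -
  have "(\<lambda>a. a \<bullet> g) = (\<lambda>v. 0)"
    using assms by (intro differential_zero_maxmin[of x S f]) auto
  then have "g \<bullet> g = 0" by meson
  then show ?thesis by simp
qed

text \<open>Crude norm bounds from entrywise bounds; the growth conditions only ask for some constant.\<close>

lemma norm_matrix_apply_le:
  fixes m :: "'n::finite \<Rightarrow> 'n \<Rightarrow> real"
  assumes "\<And>i j. \<bar>m i j\<bar> \<le> B"
  shows "\<bar>\<Sum>i\<in>UNIV. a $ i * m i j\<bar> \<le> real CARD('n) * B * norm a"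
    and "norm (\<chi> j. \<Sum>i\<in>UNIV. a $ i * m i j) \<le> (real CARD('n))\<^sup>2 * B * norm a"
proof -
  show row: "\<bar>\<Sum>i\<in>UNIV. a $ i * m i j\<bar> \<le> real CARD('n) * B * norm a" for j
  proof -
    have "\<bar>\<Sum>i\<in>UNIV. a $ i * m i j\<bar> \<le> (\<Sum>i\<in>UNIV. \<bar>a $ i * m i j\<bar>)"
      by (rule sum_abs)
    also have "\<dots> \<le> (\<Sum>i\<in>(UNIV::'n set). norm a * B)"
      by (intro sum_mono) (auto simp: abs_mult intro!: mult_mono assms component_le_norm_cart)
    finally show ?thesis by (simp add: algebra_simps)
  qed
  have "norm (\<chi> j. \<Sum>i\<in>UNIV. a $ i * m i j) \<le> (\<Sum>j\<in>UNIV. \<bar>\<Sum>i\<in>UNIV. a $ i * m i j\<bar>)"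
    using norm_le_l1_cart[of "\<chi> j. \<Sum>i\<in>UNIV. a $ i * m i j"] by simp
  also have "\<dots> \<le> (\<Sum>j\<in>(UNIV::'n set). real CARD('n) * B * norm a)"
    by (intro sum_mono row)
  finally show "norm (\<chi> j. \<Sum>i\<in>UNIV. a $ i * m i j) \<le> (real CARD('n))\<^sup>2 * B * norm a"
    by (simp add: power2_eq_square algebra_simps)
qed

lemma norm_le_of_coercive:
  fixes w b :: "'a::real_inner"
  assumes "0 < c" "c * (norm w)\<^sup>2 \<le> w \<bullet> b"
  shows "norm w \<le> norm b / c"
proof (cases "w = 0")
  case False
  have "norm w * (c * norm w) \<le> norm w * norm b"
    using assms(2) norm_cauchy_schwarz[of w b] by (simp add: power2_eq_square algebra_simps)
  then have "c * norm w \<le> norm b" using False by simp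
  then show ?thesis using assms(1) by (simp add: field_simps)
qed (use assms in simp)

text \<open>Fenchel duality at a frozen time in local coordinates, in a form that is symmetric under exchange of
  \<open>h\<close> and \<open>l\<close>: every implication below therefore holds in both directions. The bound \<open>K\<close> on the
  zero section is the one global input; without it the growth of \<open>p\<close> in terms of \<open>v\<close> would not be
  uniform in the base point.\<close>

locale fenchel_pair = H: C2_fibered U h + L: C2_fibered U l
  for U :: "(real ^ 'n) set" and h l :: "real ^ 'n \<Rightarrow> real ^ 'n \<Rightarrow> real" +
  fixes K :: real
  assumes young: "x \<in> U \<Longrightarrow> p \<bullet> v \<le> h x p + l x v"
    and h_conjugate: "x \<in> U \<Longrightarrow> \<exists>v. p \<bullet> v = h x p + l x v"
    and l_conjugate: "x \<in> U \<Longrightarrow> \<exists>p. p \<bullet> v = h x p + l x v"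
    and zero_section_bound: "x \<in> U \<Longrightarrow> h x 0 + l x 0 \<le> K"

lemma fenchel_pair_swap:
  assumes "fenchel_pair U h l K"
  shows "fenchel_pair U l h K"
proof -
  interpret fenchel_pair U h l K by (rule assms)
  show ?thesis
  proof unfold_locales
    fix x p v assume x: "x \<in> U"
    show "p \<bullet> v \<le> l x p + h x v"
      using young[OF x, of v p] by (simp add: inner_commute add.commute)
    show "\<exists>v. p \<bullet> v = l x p + h x v"
      using l_conjugate[OF x, of p] by (simp add: inner_commute add.commute)
    show "\<exists>p. p \<bullet> v = l x p + h x v"
      using h_conjugate[OF x, of v] by (simp add: inner_commute add.commute)
    show "l x 0 + h x 0 \<le> K"
      using zero_section_bound[OF x] by (simp add: add.commute)
  qed
qed

context fenchel_pair
begin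

text \<open>The function \<open>h(x,p) + l(x,v) - p \<bullet> v\<close> is nonnegative, so its derivatives with respect to
  \<open>p\<close>, \<open>v\<close> and \<open>x\<close> vanish wherever it is zero. The last of them is the envelope identity.\<close>

lemma young_equality:
  assumes "x \<in> U" "p \<bullet> v = h x p + l x v"
  shows "fiber_grad h x p = v" "fiber_grad l x v = p" "base_grad l x v = - base_grad h x p"
proof -
  have "((\<lambda>q. h x q - q \<bullet> v) has_derivative (\<lambda>b. b \<bullet> (fiber_grad h x p - v))) (at p)"
    by (auto intro!: derivative_eq_intros H.has_derivative_fiber[OF assms(1)] simp: inner_diff_right)
  moreover have "h x p - p \<bullet> v \<le> h x q - q \<bullet> v" for q
    using young[OF assms(1), of q v] assms(2) by simp
  ultimately have "fiber_grad h x p - v = 0"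
    using gradient_zero_at_min[of "\<lambda>q. h x q - q \<bullet> v" _ p UNIV] by blast
  then show "fiber_grad h x p = v" by simp
  have "((\<lambda>w. l x w - p \<bullet> w) has_derivative (\<lambda>b. b \<bullet> (fiber_grad l x v - p))) (at v)"
    by (auto intro!: derivative_eq_intros L.has_derivative_fiber[OF assms(1)]
        simp: inner_diff_right inner_commute)
  moreover have "l x v - p \<bullet> v \<le> l x w - p \<bullet> w" for w
    using young[OF assms(1), of p w] assms(2) by simp
  ultimately have "fiber_grad l x v - p = 0"
    using gradient_zero_at_min[of "\<lambda>w. l x w - p \<bullet> w" _ v UNIV] by blast
  then show "fiber_grad l x v = p" by simp
  have "((\<lambda>x. h x p + l x v) has_derivative (\<lambda>a. a \<bullet> (base_grad h x p + base_grad l x v))) (at x)"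
    by (auto intro!: derivative_eq_intros H.has_derivative_base[OF assms(1)]
        L.has_derivative_base[OF assms(1)] simp: inner_add_right)
  moreover have "h x p + l x v \<le> h y p + l y v" if "y \<in> U" for y
    using young[OF that, of p v] assms(2) by simp
  ultimately have "base_grad h x p + base_grad l x v = 0"
    using gradient_zero_at_min[of "\<lambda>x. h x p + l x v" _ x U] assms(1) H.open_base by blast
  then show "base_grad l x v = - base_grad h x p" by (simp add: add_eq_0_iff)
qed

lemma legendre_inverse:
  fixes v :: "real ^ 'n"
  assumes "x \<in> U"
  defines "p \<equiv> fiber_grad l x v"
  shows "fiber_grad h x p = v" "p \<bullet> v = h x p + l x v" "base_grad l x v = - base_grad h x p"
proof -
  obtain q where "q \<bullet> v = h x q + l x v" using l_conjugate[OF assms(1)] by blast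
  with young_equality[OF assms(1) this]
  show "fiber_grad h x p = v" "p \<bullet> v = h x p + l x v" "base_grad l x v = - base_grad h x p"
    by (simp_all add: p_def)
qed

text \<open>Derivative along \<open>v\<close> of the identity \<open>D\<^sub>p h(x, D\<^sub>v l(x,v)) = v\<close>.\<close>

lemma fiber_hess_inverse:
  assumes "x \<in> U"
  shows "fiber_hess h x (fiber_grad l x v) (fiber_hess l x v b) = b"
proof -
  have "((\<lambda>v. fiber_grad h x (fiber_grad l x v)) has_derivative
      (\<lambda>b. fiber_hess h x (fiber_grad l x v) (fiber_hess l x v b))) (at v)"
    by (rule has_derivative_compose[OF L.fiber_grad_has_derivative_fiber[OF assms]
          H.fiber_grad_has_derivative_fiber[OF assms]])
  then have "((\<lambda>v. v) has_derivative
      (\<lambda>b. fiber_hess h x (fiber_grad l x v) (fiber_hess l x v b))) (at v)"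
    by (simp only: legendre_inverse(1)[OF assms])
  from has_derivative_unique[OF this has_derivative_ident] show ?thesis by meson
qed

lemma has_derivative_legendre_base:
  assumes "x \<in> U"
  shows "((\<lambda>x. (x, fiber_grad l x v)) has_derivative (\<lambda>a. (a, mixed_hess l x v a))) (at x)"
  by (intro has_derivative_Pair has_derivative_ident L.grad_has_derivative_base(1)[OF assms])

text \<open>Derivative along \<open>x\<close> of the same identity, whose right-hand side is constant in \<open>x\<close>.\<close>

lemma mixed_hess_dual:
  assumes "x \<in> U"
  shows "fiber_hess h x (fiber_grad l x v) (mixed_hess l x v a) = - mixed_hess h x (fiber_grad l x v) a"
proof -
  let ?p = "fiber_grad l x v"
  have "((\<lambda>x. fiber_grad h x (fiber_grad l x v)) has_derivative
      (\<lambda>a. mixed_hess h x ?p a + fiber_hess h x ?p (mixed_hess l x v a))) (at x)"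
    using has_derivative_compose[OF has_derivative_legendre_base[OF assms]
          H.has_derivative_fiber_grad[OF assms]] by simp
  then have "((\<lambda>x. v) has_derivative
      (\<lambda>a. mixed_hess h x ?p a + fiber_hess h x ?p (mixed_hess l x v a))) (at x)"
    by (rule has_derivative_transform_within_open[OF _ H.open_base assms]) (rule legendre_inverse(1))
  from has_derivative_unique[OF this has_derivative_const]
  have "mixed_hess h x ?p a + fiber_hess h x ?p (mixed_hess l x v a) = 0" by meson
  then show ?thesis by (simp add: eq_neg_iff_add_eq_0 add.commute)
qed

text \<open>Derivative along \<open>x\<close> of the envelope identity \<open>D\<^sub>x l(x,v) = - D\<^sub>x h(x, D\<^sub>v l(x,v))\<close>.\<close>

lemma base_hess_dual:
  assumes "x \<in> U"
  shows "base_hess l x v a = - (base_hess h x (fiber_grad l x v) a +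
    mixed_hess_transpose h x (fiber_grad l x v) (mixed_hess l x v a))"
proof -
  let ?p = "fiber_grad l x v"
  have "((\<lambda>x. - base_grad h x (fiber_grad l x v)) has_derivative
      (\<lambda>a. - (base_hess h x ?p a + mixed_hess_transpose h x ?p (mixed_hess l x v a)))) (at x)"
    using has_derivative_minus[OF has_derivative_compose[OF has_derivative_legendre_base[OF assms]
          H.has_derivative_base_grad[OF assms]]] by simp
  then have "((\<lambda>x. base_grad l x v) has_derivative
      (\<lambda>a. - (base_hess h x ?p a + mixed_hess_transpose h x ?p (mixed_hess l x v a)))) (at x)"
    by (rule has_derivative_transform_within_open[OF _ H.open_base assms])
      (simp only: legendre_inverse(3))
  from has_derivative_unique[OF L.grad_has_derivative_base(2)[OF assms] this] show ?thesis by meson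
qed

lemma zero_section_bound_nonneg: "x \<in> U \<Longrightarrow> 0 \<le> K"
  using young[of x 0 0] zero_section_bound[of x] by simp

text \<open>Let \<open>p = D\<^sub>v l(x,v)\<close>. Young's inequality at \<open>(p,0)\<close> gives \<open>h(x,0) - h(x,p) \<le> h(x,0) + l(x,0) \<le> K\<close>,
  while strong convexity around \<open>p\<close>, where the gradient is \<open>v\<close>, gives
  \<open>h(x,0) - h(x,p) \<ge> c/2 |p|\<^sup>2 - p \<bullet> v\<close>. Hence \<open>c/2 |p|\<^sup>2 \<le> K + |p| |v|\<close>, and \<open>p\<close> grows at most
  linearly in \<open>v\<close>. The form \<open>1 + |p|\<close> is the one in which the growth conditions are stated.\<close>

lemma legendre_growth:
  assumes "x \<in> U" "0 < c" and lower: "\<And>p u. c * (norm u)\<^sup>2 \<le> u \<bullet> fiber_hess h x p u"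
  shows "1 + norm (fiber_grad l x v) \<le> (2 + 2 * (K + 1) / c) * (1 + norm v)"
proof -
  let ?p = "fiber_grad l x v"
  have K: "0 \<le> K" using zero_section_bound_nonneg assms(1) by blast
  have "c / 2 * (norm ?p)\<^sup>2 \<le> K + ?p \<bullet> v"
    using H.fiber_strongly_convex[OF assms(1) lower, where p = ?p and q = 0]
      young[OF assms(1), of ?p 0] zero_section_bound[OF assms(1)]
    by (simp add: legendre_inverse[OF assms(1)])
  also have "\<dots> \<le> K + norm ?p * norm v" using norm_cauchy_schwarz[of ?p v] by simp
  finally have *: "c / 2 * (norm ?p)\<^sup>2 \<le> K + norm ?p * norm v" .
  have "norm ?p \<le> 1 + 2 * (K + norm v) / c"
  proof (cases "norm ?p \<le> 1")
    case True
    then show ?thesis using K assms(2) by (simp add: add_increasing2)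
  next
    case False
    then have "K \<le> norm ?p * K" using K by (simp add: mult_le_cancel_right1)
    with * have "norm ?p * (c / 2 * norm ?p) \<le> norm ?p * (K + norm v)"
      by (simp add: power2_eq_square algebra_simps)
    then have "c / 2 * norm ?p \<le> K + norm v"
      by (rule mult_left_le_imp_le) (use False in linarith)
    then have "norm ?p \<le> 2 * (K + norm v) / c" using assms(2) by (simp add: field_simps)
    then show ?thesis by simp
  qed
  moreover have "2 * (K + norm v) / c \<le> 2 * (K + 1) / c * (1 + norm v)"
    using K assms(2) by (simp add: field_simps)
  moreover have "1 + r \<le> 2 * (1 + s) + X" if "r \<le> 1 + Y" "Y \<le> X" "0 \<le> s" for r s X Y :: real
    using that by simp
  ultimately show ?thesis
    unfolding distrib_right[of 2] using norm_ge_zero by blast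
qed

text \<open>The fiber Hessian of \<open>l\<close> is the inverse of that of \<open>h\<close>. Coercivity of a matrix bounds the norm
  of its inverse, and a norm bound on a coercive matrix makes the inverse coercive.\<close>

lemma dual_fiber_hess_bounds:
  assumes "x \<in> U" "0 < c" "0 < C"
    and lower: "\<And>p u. c * (norm u)\<^sup>2 \<le> u \<bullet> fiber_hess h x p u"
    and upper: "\<And>p i j. \<bar>d2_fiber_fiber i j h x p\<bar> \<le> C"
  shows "\<bar>d2_fiber_fiber i j l x v\<bar> \<le> 1 / c"
    and "c / ((real CARD('n))\<^sup>2 * C)\<^sup>2 * (norm u)\<^sup>2 \<le> u \<bullet> fiber_hess l x v u"
proof -
  let ?w = "fiber_hess l x v" and ?p = "fiber_grad l x v"
  note inv = fiber_hess_inverse[OF assms(1)]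
  have "norm (?w (axis i 1)) \<le> norm (axis i 1 :: real ^ 'n) / c"
    using lower[of "?w (axis i 1)" ?p] by (intro norm_le_of_coercive assms(2)) (simp add: inv)
  moreover have "?w (axis i 1) $ j = d2_fiber_fiber i j l x v"
    by (simp add: fiber_hess_def sum_axis_mult)
  ultimately show "\<bar>d2_fiber_fiber i j l x v\<bar> \<le> 1 / c"
    using component_le_norm_cart[of "?w (axis i 1)" j] by simp
  let ?N = "(real CARD('n))\<^sup>2 * C"
  have N: "0 < ?N" using assms(3) by simp
  have "norm u \<le> ?N * norm (?w u)"
    using norm_matrix_apply_le(2)[of "\<lambda>i j. d2_fiber_fiber i j h x ?p", OF upper, of "?w u"] inv[of v u]
    by (simp add: fiber_hess_def)
  then have "norm u / ?N \<le> norm (?w u)"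
    by (subst pos_divide_le_eq[OF N]) (simp only: mult.commute)
  then have "(norm u / ?N)\<^sup>2 \<le> (norm (?w u))\<^sup>2"
    using N by (intro power_mono divide_nonneg_pos) auto
  then have "c * (norm u / ?N)\<^sup>2 \<le> c * (norm (?w u))\<^sup>2"
    using assms(2) by (intro mult_left_mono) auto
  also have "\<dots> \<le> ?w u \<bullet> u" using lower[of "?w u" ?p] by (simp add: inv)
  finally show "c / ?N\<^sup>2 * (norm u)\<^sup>2 \<le> u \<bullet> ?w u" by (simp add: inner_commute power_divide)
qed

text \<open>The mixed Hessian of \<open>l\<close> is, up to sign, the inverse fiber Hessian of \<open>h\<close> applied to the mixed
  Hessian of \<open>h\<close>, hence \<open>O(1 + |p|)\<close>; the base Hessian of \<open>l\<close> is, again up to sign, the base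
  Hessian of \<open>h\<close> plus a product of two mixed terms, hence \<open>O(1 + |p|\<^sup>2)\<close>. The linear growth of \<open>p\<close> turns these into bounds in \<open>v\<close>.\<close>

lemma dual_base_bounds:
  assumes "x \<in> U" "0 < c" "0 < B"
    and lower: "\<And>p u. c * (norm u)\<^sup>2 \<le> u \<bullet> fiber_hess h x p u"
    and mixed: "\<And>p i j. \<bar>d2_base_fiber i j h x p\<bar> \<le> B * (1 + norm p)"
    and base: "\<And>p i j. \<bar>d2_base_base i j h x p\<bar> \<le> B * (1 + (norm p)\<^sup>2)"
  defines "G \<equiv> 2 + 2 * (K + 1) / c" and "N \<equiv> real CARD('n)"
  shows "\<bar>d2_base_fiber i j l x v\<bar> \<le> N\<^sup>2 * B * G / c * (1 + norm v)"
    and "\<bar>d2_base_base i j l x v\<bar> \<le> 2 * (B + N ^ 3 * B\<^sup>2 / c) * G\<^sup>2 * (1 + (norm v)\<^sup>2)"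
proof -
  let ?p = "fiber_grad l x v"
  let ?w = "mixed_hess l x v (axis i 1)"
  let ?r = "1 + norm ?p"
  have growth: "?r \<le> G * (1 + norm v)"
    unfolding G_def by (rule legendre_growth[OF assms(1,2) lower])
  have "norm ?w \<le> norm (mixed_hess h x ?p (axis i 1)) / c"
    using norm_le_of_coercive[OF assms(2) lower[of ?w ?p]] by (simp add: mixed_hess_dual[OF assms(1)])
  also have "norm (mixed_hess h x ?p (axis i 1)) \<le> N\<^sup>2 * (B * ?r) * norm (axis i 1 :: real ^ 'n)"
    unfolding mixed_hess_def N_def by (rule norm_matrix_apply_le(2)) (rule mixed)
  finally have w: "norm ?w \<le> N\<^sup>2 * B / c * ?r"
    using assms(2) by (simp add: divide_right_mono)
  have "?w $ j = d2_base_fiber i j l x v"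
    by (simp add: mixed_hess_def sum_axis_mult)
  then have "\<bar>d2_base_fiber i j l x v\<bar> \<le> norm ?w" by (metis component_le_norm_cart)
  also note w
  also have "N\<^sup>2 * B / c * ?r \<le> N\<^sup>2 * B / c * (G * (1 + norm v))"
    using growth assms(2,3) by (intro mult_left_mono) (auto simp: N_def)
  finally show "\<bar>d2_base_fiber i j l x v\<bar> \<le> N\<^sup>2 * B * G / c * (1 + norm v)" by simp
  have "\<bar>mixed_hess_transpose h x ?p ?w $ j\<bar> \<le> N * (B * ?r) * norm ?w"
    unfolding mixed_hess_transpose_def N_def vec_lambda_beta
    using norm_matrix_apply_le(1)[of "\<lambda>i j. d2_base_fiber j i h x ?p", OF mixed] .
  also have "\<dots> \<le> N * (B * ?r) * (N\<^sup>2 * B / c * ?r)"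
    using w assms(3) by (intro mult_left_mono) (auto simp: N_def)
  also have "\<dots> = N ^ 3 * B\<^sup>2 / c * ?r\<^sup>2" by (simp add: power2_eq_square power3_eq_cube)
  finally have 1: "\<bar>mixed_hess_transpose h x ?p ?w $ j\<bar> \<le> N ^ 3 * B\<^sup>2 / c * ?r\<^sup>2" .
  have "\<bar>base_hess h x ?p (axis i 1) $ j\<bar> \<le> B * (1 + (norm ?p)\<^sup>2)"
    using base by (simp add: base_hess_def sum_axis_mult)
  also have "\<dots> \<le> B * ?r\<^sup>2" using assms(3) by (intro mult_left_mono) (auto simp: power2_sum)
  finally have 2: "\<bar>base_hess h x ?p (axis i 1) $ j\<bar> \<le> B * ?r\<^sup>2" .
  have "d2_base_base i j l x v = base_hess l x v (axis i 1) $ j"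
    by (simp add: base_hess_def sum_axis_mult)
  then have "\<bar>d2_base_base i j l x v\<bar> \<le> B * ?r\<^sup>2 + N ^ 3 * B\<^sup>2 / c * ?r\<^sup>2"
    using 1 2 by (simp add: base_hess_dual[OF assms(1)])
  also have "\<dots> = (B + N ^ 3 * B\<^sup>2 / c) * ?r\<^sup>2" by (simp add: algebra_simps)
  also have "\<dots> \<le> (B + N ^ 3 * B\<^sup>2 / c) * (2 * G\<^sup>2 * (1 + (norm v)\<^sup>2))"
  proof (rule mult_left_mono)
    have "?r\<^sup>2 \<le> (G * (1 + norm v))\<^sup>2" using growth by (intro power_mono) auto
    also have "\<dots> = G\<^sup>2 * (1 + norm v)\<^sup>2" by (rule power_mult_distrib)
    also have "\<dots> \<le> G\<^sup>2 * (2 * (1 + (norm v)\<^sup>2))"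
      using sum_squares_bound[of 1 "norm v"] by (intro mult_left_mono) (auto simp: power2_sum)
    finally show "?r\<^sup>2 \<le> 2 * G\<^sup>2 * (1 + (norm v)\<^sup>2)" by (simp add: algebra_simps)
    show "0 \<le> B + N ^ 3 * B\<^sup>2 / c" using assms(2,3) by (simp add: N_def)
  qed
  finally show "\<bar>d2_base_base i j l x v\<bar> \<le> 2 * (B + N ^ 3 * B\<^sup>2 / c) * G\<^sup>2 * (1 + (norm v)\<^sup>2)"
    by (simp only: ac_simps)
qed

end

section \<open>Coordinates on the tangent and cotangent bundle\<close>

lemma chart_inv_coord: "is_chart M c \<Longrightarrow> q \<in> fst c \<Longrightarrow> chart_inv c (snd c q) = q"
proof -
  assume c: "is_chart M c" and q: "q \<in> fst c"
  have "inj_on (snd c) (topspace (subtopology M (fst c)))"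
    using c homeomorphic_imp_injective_map unfolding is_chart_def by blast
  moreover have "topspace (subtopology M (fst c)) = fst c"
    using c openin_subset unfolding is_chart_def by fastforce
  ultimately show ?thesis using q by (simp add: chart_inv_def)
qed

lemma chart_inv_mem: "x \<in> snd c ` fst c \<Longrightarrow> chart_inv c x \<in> fst c"
  by (simp add: chart_inv_def inv_into_into)

lemma chart_image_open:
  assumes "is_chart M c" "openin M W"
  shows "open (snd c ` (fst c \<inter> W))"
proof -
  have "openin (subtopology M (fst c)) (fst c \<inter> W)"
    using assms(2) by (rule openin_subtopology_Int2)
  then have "openin (top_of_set (snd c ` fst c)) (snd c ` (fst c \<inter> W))"
    using assms(1) homeomorphic_imp_open_map unfolding is_chart_def open_map_def by blast
  then show ?thesis using assms(1) openin_open_trans unfolding is_chart_def by blast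
qed

lemma chart_preimage_open:
  assumes "is_chart M c" "open V"
  shows "openin M {q \<in> fst c. snd c q \<in> V}"
proof -
  have "continuous_map (subtopology M (fst c)) (top_of_set (snd c ` fst c)) (snd c)"
    using assms(1) homeomorphic_imp_continuous_map unfolding is_chart_def by blast
  moreover have "openin (top_of_set (snd c ` fst c)) (snd c ` fst c \<inter> V)"
    using assms(2) by (simp add: openin_open_Int)
  ultimately have "openin (subtopology M (fst c))
      {q \<in> topspace (subtopology M (fst c)). snd c q \<in> snd c ` fst c \<inter> V}"
    by (rule openin_continuous_map_preimage)
  moreover have dom: "openin M (fst c)" using assms(1) by (simp add: is_chart_def)
  then have "topspace (subtopology M (fst c)) = fst c"
    using openin_subset by fastforce
  then have "{q \<in> topspace (subtopology M (fst c)). snd c q \<in> snd c ` fst c \<inter> V} =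
      {q \<in> fst c. snd c q \<in> V}" by auto
  ultimately show ?thesis using openin_trans_full[OF _ dom] by simp
qed

context
  fixes M :: "'a topology" and \<A> :: "('a, 'n::finite) chart set" and k :: nat
  assumes manifold: "Ck_manifold (Suc k) M \<A>"
begin

lemma atlas_chart: "c \<in> \<A> \<Longrightarrow> is_chart M c"
  using manifold unfolding Ck_manifold_def by blast

lemma chart_domain_open: "c \<in> \<A> \<Longrightarrow> openin M (fst c)"
  using atlas_chart unfolding is_chart_def by blast

lemma transition_coord:
  "c \<in> charts_at \<A> q \<Longrightarrow> transition c d (snd c q) = snd d q"
  using chart_inv_coord[OF atlas_chart] by (simp add: transition_def charts_at_def)

lemma transition_has_derivative:
  assumes "c \<in> charts_at \<A> q" "d \<in> charts_at \<A> q"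
  shows "(transition c d has_derivative frechet_derivative (transition c d) (at (snd c q))) (at (snd c q))"
proof -
  have "Ck_on (Suc k) (snd c ` (fst c \<inter> fst d)) (transition c d)"
    using manifold assms unfolding Ck_manifold_def compatible_def charts_at_def by blast
  then have "transition c d differentiable (at (snd c q))"
    using assms by (auto simp: charts_at_def)
  then show ?thesis using frechet_derivative_works by blast
qed

lemma transition_derivative_chain:
  assumes "c \<in> charts_at \<A> q" "d \<in> charts_at \<A> q" "e \<in> charts_at \<A> q"
  shows "frechet_derivative (transition d e) (at (snd d q))
      (frechet_derivative (transition c d) (at (snd c q)) v) =
    frechet_derivative (transition c e) (at (snd c q)) v"
proof -
  let ?S = "snd c ` (fst c \<inter> (fst d \<inter> fst e))"
  have A: "c \<in> \<A>" "d \<in> \<A>" "e \<in> \<A>" "q \<in> fst c" "q \<in> fst d" "q \<in> fst e"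
    using assms by (auto simp: charts_at_def)
  have "(transition d e has_derivative frechet_derivative (transition d e) (at (snd d q)))
      (at (transition c d (snd c q)))"
    using transition_has_derivative[OF assms(2,3)] by (simp add: transition_coord[OF assms(1)])
  from has_derivative_compose[OF transition_has_derivative[OF assms(1,2)] this]
  have "((\<lambda>y. transition d e (transition c d y)) has_derivative
      (\<lambda>v. frechet_derivative (transition d e) (at (snd d q))
        (frechet_derivative (transition c d) (at (snd c q)) v))) (at (snd c q))" .
  moreover have "open ?S"
    using A by (intro chart_image_open[OF atlas_chart] openin_Int chart_domain_open)
  moreover have "snd c q \<in> ?S" using A by blast
  moreover have "transition d e (transition c d y) = transition c e y" if "y \<in> ?S" for y
    using that A(1-3) by (auto simp: transition_coord charts_at_def)
  ultimately have "(transition c e has_derivative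
      (\<lambda>v. frechet_derivative (transition d e) (at (snd d q))
        (frechet_derivative (transition c d) (at (snd c q)) v))) (at (snd c q))"
    by (rule has_derivative_transform_within_open)
  from fun_cong[OF has_derivative_unique[OF this transition_has_derivative[OF assms(1,3)]], of v]
  show ?thesis .
qed

lemma transition_derivative_self:
  assumes "c \<in> charts_at \<A> q"
  shows "frechet_derivative (transition c c) (at (snd c q)) v = v"
proof -
  have A: "c \<in> \<A>" "q \<in> fst c" using assms by (auto simp: charts_at_def)
  have "((\<lambda>y. y) has_derivative (\<lambda>v. v)) (at (snd c q))" by (rule has_derivative_ident)
  moreover have "open (snd c ` fst c)" using atlas_chart[OF A(1)] by (simp add: is_chart_def)
  moreover have "snd c q \<in> snd c ` fst c" using A by blast
  moreover have "y = transition c c y" if "y \<in> snd c ` fst c" for y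
    using that A(1) by (auto simp: transition_coord charts_at_def)
  ultimately have "(transition c c has_derivative (\<lambda>v. v)) (at (snd c q))"
    by (rule has_derivative_transform_within_open)
  from fun_cong[OF has_derivative_unique[OF transition_has_derivative[OF assms assms] this], of v]
  show ?thesis .
qed

lemma tvec_of_self: "c \<in> charts_at \<A> q \<Longrightarrow> tvec_of \<A> c q v c = v"
  by (simp add: tvec_of_def transition_derivative_self)

text \<open>That the coordinate expressions of \<open>tvec_of\<close> in all charts are compatible is the chain rule for
  transition maps. With the next lemmas, \<open>v \<mapsto> tvec_of \<A> c q v\<close> and \<open>p \<mapsto> covec_of \<A> c q p\<close> are
  parametrizations of the tangent and cotangent space that carry the pairing to the inner product.\<close>

lemma tvec_of_mem: "c \<in> charts_at \<A> q \<Longrightarrow> tvec_of \<A> c q v \<in> tangent_space \<A> q"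
  by (simp add: tangent_space_def tvec_of_def transition_derivative_chain)

lemma tangent_eq_tvec_of:
  assumes "c \<in> charts_at \<A> q" "\<xi> \<in> tangent_space \<A> q"
  shows "\<xi> = tvec_of \<A> c q (\<xi> c)"
proof
  fix d
  have "d \<notin> charts_at \<A> q \<Longrightarrow> \<xi> d = 0"
    "d \<in> charts_at \<A> q \<Longrightarrow> \<xi> d = frechet_derivative (transition c d) (at (snd c q)) (\<xi> c)"
    using assms unfolding tangent_space_def by blast+
  then show "\<xi> d = tvec_of \<A> c q (\<xi> c) d"
    unfolding tvec_of_def by presburger
qed

lemma tvec_of_linear:
  assumes "c \<in> charts_at \<A> q"
  shows "tvec_of \<A> c q (a *\<^sub>R v + b *\<^sub>R w) = (\<lambda>d. a *\<^sub>R tvec_of \<A> c q v d + b *\<^sub>R tvec_of \<A> c q w d)"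
proof
  fix d
  show "tvec_of \<A> c q (a *\<^sub>R v + b *\<^sub>R w) d = a *\<^sub>R tvec_of \<A> c q v d + b *\<^sub>R tvec_of \<A> c q w d"
  proof (cases "d \<in> charts_at \<A> q")
    case True
    have "linear (frechet_derivative (transition c d) (at (snd c q)))"
      using transition_has_derivative[OF assms True] by (rule has_derivative_linear)
    with True show ?thesis by (simp add: tvec_of_def linear_add linear_scale)
  qed (simp add: tvec_of_def)
qed

lemma covec_of_tvec_of:
  "c \<in> charts_at \<A> q \<Longrightarrow> covec_of \<A> c q p (tvec_of \<A> c q v) = p \<bullet> v"
  by (simp add: covec_of_def tvec_of_mem tvec_of_self)

lemma covec_of_mem:
  assumes "c \<in> charts_at \<A> q"
  shows "covec_of \<A> c q p \<in> cotangent_space \<A> q"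
proof -
  have "covec_of \<A> c q p (\<lambda>d. a *\<^sub>R \<xi> d + b *\<^sub>R \<eta> d) =
      a * covec_of \<A> c q p \<xi> + b * covec_of \<A> c q p \<eta>"
    if \<xi>: "\<xi> \<in> tangent_space \<A> q" and \<eta>: "\<eta> \<in> tangent_space \<A> q" for \<xi> \<eta> a b
  proof -
    obtain v w where "\<xi> = tvec_of \<A> c q v" "\<eta> = tvec_of \<A> c q w"
      using tangent_eq_tvec_of[OF assms \<xi>] tangent_eq_tvec_of[OF assms \<eta>] by metis
    then show ?thesis
      by (simp add: tvec_of_linear[OF assms, symmetric] covec_of_tvec_of[OF assms] inner_add_right)
  qed
  then show ?thesis by (simp add: cotangent_space_def covec_of_def)
qed

lemma cotangent_eq_covec_of:
  assumes "c \<in> charts_at \<A> q" "\<alpha> \<in> cotangent_space \<A> q"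
  obtains p where "\<alpha> = covec_of \<A> c q p"
proof
  let ?p = "\<chi> i. \<alpha> (tvec_of \<A> c q (axis i 1))"
  have comb: "\<alpha> (tvec_of \<A> c q (a *\<^sub>R v + b *\<^sub>R w)) =
      a * \<alpha> (tvec_of \<A> c q v) + b * \<alpha> (tvec_of \<A> c q w)" for a b v w
    using assms(2) by (simp add: tvec_of_linear[OF assms(1)] cotangent_space_def tvec_of_mem[OF assms(1)])
  have "linear (\<lambda>v. \<alpha> (tvec_of \<A> c q v))"
    using comb[of 1 _ 1] comb[of _ _ 0] by (intro linearI) simp_all
  then have pair: "\<alpha> (tvec_of \<A> c q v) = ?p \<bullet> v" for v
    by (subst linear_axis_expansion) (simp_all add: inner_vec_def mult.commute)
  show "\<alpha> = covec_of \<A> c q ?p"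
  proof
    fix \<xi>
    show "\<alpha> \<xi> = covec_of \<A> c q ?p \<xi>"
    proof (cases "\<xi> \<in> tangent_space \<A> q")
      case True
      obtain v where v: "\<xi> = tvec_of \<A> c q v"
        using tangent_eq_tvec_of[OF assms(1) True] by metis
      show ?thesis
        unfolding v by (rule trans[OF pair covec_of_tvec_of[OF assms(1), symmetric]])
    next
      case False
      then show ?thesis using assms(2) by (simp add: cotangent_space_def covec_of_def)
    qed
  qed
qed

text \<open>The zero section does not depend on the coordinates; a quantity evaluated on it is a function on the manifold.\<close>

lemma zero_section:
  assumes "c \<in> charts_at \<A> q"
  shows "tvec_of \<A> c q 0 = (\<lambda>_. 0)" "covec_of \<A> c q 0 = (\<lambda>_. 0)"
  using tvec_of_linear[OF assms, of 0 0 0 0] by (simp_all add: covec_of_def fun_eq_iff)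

text \<open>Periodicity reduces to times in \<open>[0,1]\<close>; then the function lives on a compact space. Continuity is
  available chart by chart, so boundedness is proved near each point and patched together by a
  finite subcover.\<close>

lemma periodic_continuous_bounded:
  fixes f :: "real \<Rightarrow> 'a \<Rightarrow> real"
  assumes "compact_space M"
    and cont: "\<And>c. c \<in> \<A> \<Longrightarrow> continuous_on (UNIV \<times> snd c ` fst c) (\<lambda>(t, x). f t (chart_inv c x))"
    and periodic: "\<And>t q. q \<in> topspace M \<Longrightarrow> f (t + 1) q = f t q"
  obtains K where "\<And>t q. q \<in> topspace M \<Longrightarrow> f t q \<le> K"
proof -
  define \<W> where "\<W> = {W. openin M W \<and> (\<exists>K. \<forall>t\<in>{0..1}. \<forall>q\<in>W. f t q \<le> K)}"
  have "\<exists>W\<in>\<W>. q \<in> W" if "q \<in> topspace M" for q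
  proof -
    have "topspace M = (\<Union>c\<in>\<A>. fst c)" using manifold unfolding Ck_manifold_def by blast
    with that obtain c where c: "c \<in> \<A>" "q \<in> fst c" by blast
    then have "open (snd c ` fst c)" using atlas_chart unfolding is_chart_def by blast
    then obtain r where r: "r > 0" "cball (snd c q) r \<subseteq> snd c ` fst c"
      using c open_contains_cball by blast
    let ?Q = "{0..1::real} \<times> cball (snd c q) r"
    have "continuous_on ?Q (\<lambda>(t, x). f t (chart_inv c x))"
      by (rule continuous_on_subset[OF cont[OF c(1)]]) (use r in auto)
    then have "compact ((\<lambda>(t, x). f t (chart_inv c x)) ` ?Q)"
      by (intro compact_continuous_image compact_Times) auto
    then have "bounded ((\<lambda>(t, x). f t (chart_inv c x)) ` ?Q)" by (rule compact_imp_bounded)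
    then obtain K where K: "\<And>y. y \<in> (\<lambda>(t, x). f t (chart_inv c x)) ` ?Q \<Longrightarrow> norm y \<le> K"
      unfolding bounded_iff by blast
    let ?W = "{q' \<in> fst c. snd c q' \<in> ball (snd c q) r}"
    have "f t q' \<le> K" if "t \<in> {0..1}" "q' \<in> ?W" for t q'
    proof -
      have "f t (chart_inv c (snd c q')) \<in> (\<lambda>(t, x). f t (chart_inv c x)) ` ?Q"
        using that by (intro image_eqI[of _ _ "(t, snd c q')"]) auto
      from K[OF this] show ?thesis
        using that chart_inv_coord[OF atlas_chart[OF c(1)], of q'] by simp
    qed
    moreover have "openin M ?W" by (intro chart_preimage_open atlas_chart c(1)) simp
    ultimately have "?W \<in> \<W>" unfolding \<W>_def by blast
    then show ?thesis using c(2) r(1) by (intro bexI[of _ ?W]) auto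
  qed
  then have "topspace M \<subseteq> \<Union>\<W>" by blast
  moreover have "\<And>W. W \<in> \<W> \<Longrightarrow> openin M W" by (simp add: \<W>_def)
  ultimately obtain \<F> where \<F>: "finite \<F>" "\<F> \<subseteq> \<W>" "topspace M \<subseteq> \<Union>\<F>"
    using assms(1) unfolding compact_space_def compactin_def by (metis (no_types, lifting))
  have "\<forall>W\<in>\<F>. \<exists>K. \<forall>t\<in>{0..1}. \<forall>q\<in>W. f t q \<le> K" using \<F>(2) unfolding \<W>_def by blast
  then obtain \<kappa> where \<kappa>: "\<And>W t q. W \<in> \<F> \<Longrightarrow> t \<in> {0..1} \<Longrightarrow> q \<in> W \<Longrightarrow> f t q \<le> \<kappa> W"
    using bchoice[of \<F> "\<lambda>W K. \<forall>t\<in>{0..1}. \<forall>q\<in>W. f t q \<le> K"] by blast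
  have "f t q \<le> Max (\<kappa> ` \<F>)" if q: "q \<in> topspace M" for t q
  proof -
    have shift: "f (s + real n) q = f s q" for s n
    proof (induction n)
      case (Suc n)
      then show ?case using periodic[OF q, of "s + real n"] by (simp add: add.assoc add.commute[of 1])
    qed simp
    have "f t q = f (frac t) q"
    proof (cases "0 \<le> \<lfloor>t\<rfloor>")
      case True
      then have "frac t + real (nat \<lfloor>t\<rfloor>) = t" by (simp add: frac_def)
      with shift[of "frac t" "nat \<lfloor>t\<rfloor>"] show ?thesis by simp
    next
      case False
      then have "t + real (nat (- \<lfloor>t\<rfloor>)) = frac t" by (simp add: frac_def)
      with shift[of t "nat (- \<lfloor>t\<rfloor>)"] show ?thesis by simp
    qed
    moreover obtain W where W: "W \<in> \<F>" "q \<in> W" using \<F>(3) q by blast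
    moreover have "frac t \<in> {0..1}" using frac_lt_1[of t] by (simp add: less_imp_le)
    ultimately have "f t q \<le> \<kappa> W" using \<kappa> by simp
    also have "\<dots> \<le> Max (\<kappa> ` \<F>)" using \<F>(1) W by simp
    finally show ?thesis .
  qed
  then show ?thesis using that by blast
qed

end

text \<open>All that will be used of the Legendre duality: Young's inequality, with equality attained for
  every \<open>\<xi>\<close> and for every \<open>\<alpha>\<close>. Attainment comes from the surjectivity of the two Legendre maps, so
  the fiber derivatives \<open>DpH\<close> and \<open>DvL\<close> never have to be computed in coordinates.\<close>

lemma legendre_dual_attained:
  assumes "fiberwise_legendre_dual M \<A> H L" "q \<in> topspace M"
  shows "\<xi> \<in> tangent_space \<A> q \<Longrightarrow> \<exists>\<alpha>\<in>cotangent_space \<A> q. \<alpha> \<xi> = H t (q, \<alpha>) + L t (q, \<xi>)"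
    and "\<alpha> \<in> cotangent_space \<A> q \<Longrightarrow> \<exists>\<xi>\<in>tangent_space \<A> q. \<alpha> \<xi> = H t (q, \<alpha>) + L t (q, \<xi>)"
    and "\<xi> \<in> tangent_space \<A> q \<Longrightarrow> \<alpha> \<in> cotangent_space \<A> q \<Longrightarrow> \<alpha> \<xi> \<le> H t (q, \<alpha>) + L t (q, \<xi>)"
proof -
  note diffeo = assms(1)[unfolded fiberwise_legendre_dual_def legendre_diffeo_def, THEN conjunct1]
  note bij = diffeo[THEN conjunct1, THEN bij_betw_imp_surj_on]
    diffeo[THEN conjunct2, THEN conjunct1, THEN bij_betw_imp_surj_on]
  have H: "\<exists>\<alpha>\<in>cotangent_space \<A> q. \<xi> = DpH \<A> H t q \<alpha>" if "\<xi> \<in> tangent_space \<A> q" for \<xi>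
  proof -
    have "(t, q, \<xi>) \<in> UNIV \<times> TM M \<A>" using that assms(2) by (simp add: TM_def)
    then have "(t, q, \<xi>) \<in> legendre_H \<A> H ` (UNIV \<times> coTM M \<A>)" by (simp only: bij)
    then show ?thesis by (auto simp: legendre_H_def coTM_def)
  qed
  have L: "\<exists>\<xi>\<in>tangent_space \<A> q. \<alpha> = DvL \<A> L t q \<xi>" if "\<alpha> \<in> cotangent_space \<A> q" for \<alpha>
  proof -
    have "(t, q, \<alpha>) \<in> UNIV \<times> coTM M \<A>" using that assms(2) by (simp add: coTM_def)
    then have "(t, q, \<alpha>) \<in> legendre_L \<A> L ` (UNIV \<times> TM M \<A>)" by (simp only: bij)
    then show ?thesis by (auto simp: legendre_L_def TM_def)
  qed
  note max = assms(1)[unfolded fiberwise_legendre_dual_def, THEN conjunct2, THEN conjunct1,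
      rule_format, OF assms(2)]
  note inv = assms(1)[unfolded fiberwise_legendre_dual_def, THEN conjunct2, THEN conjunct2,
      rule_format, OF assms(2)]
  show "\<exists>\<alpha>\<in>cotangent_space \<A> q. \<alpha> \<xi> = H t (q, \<alpha>) + L t (q, \<xi>)" if \<xi>: "\<xi> \<in> tangent_space \<A> q"
  proof -
    obtain \<alpha> where \<alpha>: "\<alpha> \<in> cotangent_space \<A> q" "\<xi> = DpH \<A> H t q \<alpha>" using H[OF \<xi>] by blast
    have "\<alpha> \<xi> = H t (q, \<alpha>) + L t (q, \<xi>)" using conjunct1[OF max[OF \<xi> \<alpha>]] by linarith
    with \<alpha>(1) show ?thesis by (intro bexI[of _ \<alpha>])
  qed
  show "\<exists>\<xi>\<in>tangent_space \<A> q. \<alpha> \<xi> = H t (q, \<alpha>) + L t (q, \<xi>)" if \<alpha>: "\<alpha> \<in> cotangent_space \<A> q"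
  proof -
    obtain \<xi> where \<xi>: "\<xi> \<in> tangent_space \<A> q" "\<alpha> = DvL \<A> L t q \<xi>" using L[OF \<alpha>] by blast
    have "\<alpha> \<xi> = H t (q, \<alpha>) + L t (q, \<xi>)" using inv[OF \<alpha> \<xi>] by linarith
    with \<xi>(1) show ?thesis by (intro bexI[of _ \<xi>])
  qed
  show "\<alpha> \<xi> \<le> H t (q, \<alpha>) + L t (q, \<xi>)"
    if \<xi>: "\<xi> \<in> tangent_space \<A> q" and \<alpha>: "\<alpha> \<in> cotangent_space \<A> q"
  proof -
    obtain \<beta> where \<beta>: "\<beta> \<in> cotangent_space \<A> q" "\<xi> = DpH \<A> H t q \<beta>" using H[OF \<xi>] by blast
    have "\<alpha> \<xi> - H t (q, \<alpha>) \<le> L t (q, \<xi>)"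
      by (rule bspec[OF conjunct2[OF max[OF \<xi> \<beta>]] \<alpha>])
    then show ?thesis by linarith
  qed
qed

section \<open>Growth conditions in a chart\<close>

text \<open>The conditions on \<open>H\<close> and on \<open>L\<close> have different shapes. Both are reduced to the two predicates
  below, which make sense for \<open>H\<close> and \<open>L\<close> alike, so that one implication about a Fenchel pair can be
  used in both directions. Their constants are independent, whereas the original conditions tie them
  together.\<close>

definition fiber_bounds ::
  "(real ^ 'n) set \<Rightarrow> (real \<Rightarrow> real ^ 'n \<Rightarrow> real ^ 'n \<Rightarrow> real) \<Rightarrow> real \<Rightarrow> real \<Rightarrow> bool" where
  "fiber_bounds U F c C \<longleftrightarrow> (\<forall>t. \<forall>x\<in>U. \<forall>p.
     (\<forall>u. c * (norm u)\<^sup>2 \<le> u \<bullet> fiber_hess (F t) x p u) \<and>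
     (\<forall>i j. \<bar>d2_fiber_fiber i j (F t) x p\<bar> \<le> C))"

definition base_bounds ::
  "(real ^ 'n) set \<Rightarrow> (real \<Rightarrow> real ^ 'n \<Rightarrow> real ^ 'n \<Rightarrow> real) \<Rightarrow> real \<Rightarrow> bool" where
  "base_bounds U F B \<longleftrightarrow> (\<forall>t. \<forall>x\<in>U. \<forall>p i j.
     \<bar>d2_base_base i j (F t) x p\<bar> \<le> B * (1 + (norm p)\<^sup>2) \<and>
     \<bar>d2_base_fiber i j (F t) x p\<bar> \<le> B * (1 + norm p))"

lemma fiber_bounds_mono: "fiber_bounds U F c C \<Longrightarrow> C \<le> C' \<Longrightarrow> fiber_bounds U F c C'"
  unfolding fiber_bounds_def by (meson order_trans)

lemma base_bounds_mono:
  assumes "base_bounds U F B" "B \<le> B'"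
  shows "base_bounds U F B'"
proof -
  have "B * (1 + r) \<le> B' * (1 + r)" if "0 \<le> r" for r
    using assms(2) that by (intro mult_right_mono) auto
  then show ?thesis
    using assms(1) unfolding base_bounds_def by (meson norm_ge_zero order_trans zero_le_power2)
qed

lemma base_bounds_maxI:
  fixes F :: "real \<Rightarrow> real ^ 'a::finite \<Rightarrow> real ^ 'a \<Rightarrow> real"
  assumes "\<And>t x p i j. x \<in> U \<Longrightarrow> \<bar>d2_base_fiber i j (F t) x p\<bar> \<le> B1 * (1 + norm p)"
    and "\<And>t x p i j. x \<in> U \<Longrightarrow> \<bar>d2_base_base i j (F t) x p\<bar> \<le> B2 * (1 + (norm p)\<^sup>2)"
  shows "base_bounds U F (max B1 B2)"
  unfolding base_bounds_def
proof (intro allI ballI conjI)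
  fix t :: real and x p :: "real ^ 'a" and i j assume x: "x \<in> U"
  have "B1 * (1 + norm p) \<le> max B1 B2 * (1 + norm p)"
    "B2 * (1 + (norm p)\<^sup>2) \<le> max B1 B2 * (1 + (norm p)\<^sup>2)"
    by (intro mult_right_mono; simp)+
  with assms[OF x] show "\<bar>d2_base_base i j (F t) x p\<bar> \<le> max B1 B2 * (1 + (norm p)\<^sup>2)"
    "\<bar>d2_base_fiber i j (F t) x p\<bar> \<le> max B1 B2 * (1 + norm p)"
    by (meson order_trans)+
qed

lemma fiber_bounds_dual:
  fixes U :: "(real ^ 'n::finite) set"
  assumes pair: "\<And>t. fenchel_pair U (h t) (l t) K"
    and "0 < c" "fiber_bounds U h c C"
  shows "\<exists>c' C'. 0 < c' \<and> fiber_bounds U l c' C'"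
proof -
  \<comment> \<open>The duality bounds require a positive constant.\<close>
  let ?C = "max C 1"
  have "fiber_bounds U h c ?C" by (rule fiber_bounds_mono[OF assms(3)]) simp
  then have "\<And>t x p u. x \<in> U \<Longrightarrow> c * (norm u)\<^sup>2 \<le> u \<bullet> fiber_hess (h t) x p u"
    and "\<And>t x p i j. x \<in> U \<Longrightarrow> \<bar>d2_fiber_fiber i j (h t) x p\<bar> \<le> ?C"
    unfolding fiber_bounds_def by blast+
  note fenchel_pair.dual_fiber_hess_bounds[OF pair _ assms(2) _ this]
  then have "fiber_bounds U l (c / ((real CARD('n))\<^sup>2 * ?C)\<^sup>2) (1 / c)"
    unfolding fiber_bounds_def by simp
  moreover have "0 < c / ((real CARD('n))\<^sup>2 * ?C)\<^sup>2" using assms(2) by simp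
  ultimately show ?thesis by blast
qed

lemma base_bounds_dual:
  fixes U :: "(real ^ 'n::finite) set"
  assumes pair: "\<And>t. fenchel_pair U (h t) (l t) K"
    and "0 < c" "fiber_bounds U h c C" "base_bounds U h B"
  shows "\<exists>B'. base_bounds U l B'"
proof -
  let ?B = "max B 1" and ?N = "real CARD('n)"
  let ?G = "2 + 2 * (K + 1) / c"
  let ?B1 = "?N\<^sup>2 * ?B * ?G / c" and ?B2 = "2 * (?B + ?N ^ 3 * ?B\<^sup>2 / c) * ?G\<^sup>2"
  have "base_bounds U h ?B" by (rule base_bounds_mono[OF assms(4)]) simp
  then have "\<And>t x p i j. x \<in> U \<Longrightarrow> \<bar>d2_base_fiber i j (h t) x p\<bar> \<le> ?B * (1 + norm p)"
    and "\<And>t x p i j. x \<in> U \<Longrightarrow> \<bar>d2_base_base i j (h t) x p\<bar> \<le> ?B * (1 + (norm p)\<^sup>2)"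
    and "\<And>t x p u. x \<in> U \<Longrightarrow> c * (norm u)\<^sup>2 \<le> u \<bullet> fiber_hess (h t) x p u"
    using assms(3) unfolding base_bounds_def fiber_bounds_def by blast+
  note bounds = fenchel_pair.dual_base_bounds[OF pair _ assms(2) _ this(3,1,2)]
  have "base_bounds U l (max ?B1 ?B2)"
  proof (rule base_bounds_maxI)
    fix t x p i j assume x: "x \<in> U"
    show "\<bar>d2_base_fiber i j (l t) x p\<bar> \<le> ?B1 * (1 + norm p)"
      by (rule bounds(1)) (use x in auto)
    show "\<bar>d2_base_base i j (l t) x p\<bar> \<le> ?B2 * (1 + (norm p)\<^sup>2)"
      by (rule bounds(2)) (use x in auto)
  qed
  then show ?thesis by blast
qed

lemma cond_A_imp_fiber_bounds:
  assumes "\<And>t. C2_fibered (snd c ` fst c) (H_loc \<A> c H t)" "0 < C1" "cond_A \<A> H c C1 C2"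
  shows "fiber_bounds (snd c ` fst c) (H_loc \<A> c H) C1 C2"
proof -
  have A: "C1 * (norm u)\<^sup>2 \<le> u \<bullet> fiber_hess (H_loc \<A> c H t) x p u"
    "u \<bullet> fiber_hess (H_loc \<A> c H t) x p u \<le> C2 * (norm u)\<^sup>2" if "x \<in> snd c ` fst c" for t x p u
    using assms(3) that unfolding cond_A_def quadratic_form_eq by blast+
  have nonneg: "0 \<le> u \<bullet> fiber_hess (H_loc \<A> c H t) x p u" if "x \<in> snd c ` fst c" for t x p u
    using A(1)[OF that] assms(2) by (meson order_trans mult_nonneg_nonneg less_imp_le zero_le_power2)
  have "\<bar>d2_fiber_fiber i j (H_loc \<A> c H t) x p\<bar> \<le> C2" if x: "x \<in> snd c ` fst c" for t x p i j
    by (rule C2_fibered.d2_fiber_fiber_le_of_quadratic_form[OF assms(1) x nonneg[OF x] A(2)[OF x]])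
  with A(1) show ?thesis unfolding fiber_bounds_def by blast
qed

lemma fiber_bounds_imp_cond_A:
  fixes c :: "('a, 'n::finite) chart"
  assumes "fiber_bounds (snd c ` fst c) (H_loc \<A> c H) C1 C"
  shows "cond_A \<A> H c C1 ((real CARD('n))\<^sup>2 * C)"
proof -
  have "u \<bullet> fiber_hess (H_loc \<A> c H t) x p u \<le> (real CARD('n))\<^sup>2 * C * (norm u)\<^sup>2"
    if "x \<in> snd c ` fst c" for t x p u
  proof -
    have "\<bar>d2_fiber_fiber i j (H_loc \<A> c H t) x p\<bar> \<le> C" for i j
      using assms that unfolding fiber_bounds_def by blast
    then have "norm (fiber_hess (H_loc \<A> c H t) x p u) \<le> (real CARD('n))\<^sup>2 * C * norm u"
      unfolding fiber_hess_def by (rule norm_matrix_apply_le(2))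
    then have "norm u * norm (fiber_hess (H_loc \<A> c H t) x p u) \<le> norm u * ((real CARD('n))\<^sup>2 * C * norm u)"
      by (rule mult_left_mono) simp
    with norm_cauchy_schwarz[of u "fiber_hess (H_loc \<A> c H t) x p u"] show ?thesis
      by (simp add: power2_eq_square ac_simps)
  qed
  then show ?thesis
    using assms unfolding cond_A_def fiber_bounds_def quadratic_form_eq by blast
qed

lemma cond_A_mono:
  assumes "cond_A \<A> H c C1 C2" "C2 \<le> C2'"
  shows "cond_A \<A> H c C1 C2'"
  using assms unfolding cond_A_def by (meson mult_right_mono order_trans zero_le_power2)

lemma base_bounds_iff_cond_B: "base_bounds (snd c ` fst c) (H_loc \<A> c H) B \<longleftrightarrow> cond_B \<A> H c B"
  unfolding base_bounds_def cond_B_def by blast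

lemma base_bounds_iff_cond_D: "base_bounds (snd c ` fst c) (L_loc \<A> c L) B \<longleftrightarrow> cond_D_qq_qv \<A> L c B"
  unfolding base_bounds_def cond_D_qq_qv_def by blast

lemma fiber_bounds_iff_cond_C_Dvv:
  "fiber_bounds (snd c ` fst c) (L_loc \<A> c L) c0 C0 \<longleftrightarrow> cond_C \<A> L c c0 \<and> cond_D_vv \<A> L c C0"
  unfolding fiber_bounds_def cond_C_def cond_D_vv_def quadratic_form_eq by blast

text \<open>In the coordinates of a chart the duality on the manifold becomes a Fenchel pair at each time.\<close>

lemma fenchel_pair_local:
  fixes \<A> :: "('a, 'n::finite) chart set"
  assumes mf: "Ck_manifold (Suc k) M \<A>"
    and H: "Ck_hamiltonian 2 \<A> H" and L: "Ck_lagrangian 2 \<A> L"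
    and dual: "fiberwise_legendre_dual M \<A> H L"
    and K: "\<And>t q. q \<in> topspace M \<Longrightarrow> H t (q, \<lambda>_. 0) + L t (q, \<lambda>_. 0) \<le> K"
    and c: "c \<in> \<A>"
  shows "fenchel_pair (snd c ` fst c) (H_loc \<A> c H t) (L_loc \<A> c L t) K"
proof -
  let ?U = "snd c ` fst c"
  have openU: "open ?U"
    using atlas_chart[OF mf c] by (simp add: is_chart_def)
  then have "open (coord_domain c)"
    unfolding coord_domain_def by (intro open_Times) auto
  moreover have "{z. (t, z) \<in> coord_domain c} = ?U \<times> UNIV"
    by (auto simp: coord_domain_def)
  ultimately have C2: "Ck_on 2 (?U \<times> UNIV) (\<lambda>(x, p). H_loc \<A> c H t x p)"
      "Ck_on 2 (?U \<times> UNIV) (\<lambda>(x, v). L_loc \<A> c L t x v)"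
    using Ck_on_slice[of "coord_domain c" 2 "\<lambda>(t, x, p). H_loc \<A> c H t x p" t]
      Ck_on_slice[of "coord_domain c" 2 "\<lambda>(t, x, v). L_loc \<A> c L t x v" t]
      H L c unfolding Ck_hamiltonian_def Ck_lagrangian_def by simp_all
  have at: "c \<in> charts_at \<A> (chart_inv c x)" "chart_inv c x \<in> topspace M" if "x \<in> ?U" for x
  proof -
    have mem: "chart_inv c x \<in> fst c" using that by (rule chart_inv_mem)
    then show "c \<in> charts_at \<A> (chart_inv c x)" using c by (simp add: charts_at_def)
    show "chart_inv c x \<in> topspace M"
      using openin_subset[OF chart_domain_open[OF mf c]] mem by blast
  qed
  note loc = H_loc_def L_loc_def cotangent_param_def tangent_param_def prod.case
  show ?thesis
  proof unfold_locales
    show "open ?U" by (rule openU)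
    show "Ck_on 2 (?U \<times> UNIV) (\<lambda>(x, p). H_loc \<A> c H t x p)"
      "Ck_on 2 (?U \<times> UNIV) (\<lambda>(x, v). L_loc \<A> c L t x v)" by (rule C2)+
    fix x assume x: "x \<in> ?U"
    note at = at[OF x]
    note tv = tvec_of_mem[OF mf at(1)] and cv = covec_of_mem[OF mf at(1)]
      and pairing = covec_of_tvec_of[OF mf at(1)]
    show "p \<bullet> v \<le> H_loc \<A> c H t x p + L_loc \<A> c L t x v" for p v
      using legendre_dual_attained(3)[OF dual at(2) tv cv] unfolding loc pairing .
    show "\<exists>v. p \<bullet> v = H_loc \<A> c H t x p + L_loc \<A> c L t x v" for p
    proof -
      obtain \<xi> where \<xi>: "\<xi> \<in> tangent_space \<A> (chart_inv c x)"
        "covec_of \<A> c (chart_inv c x) p \<xi> =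
          H t (chart_inv c x, covec_of \<A> c (chart_inv c x) p) + L t (chart_inv c x, \<xi>)"
        using legendre_dual_attained(2)[OF dual at(2) cv] by blast
      obtain v where v: "\<xi> = tvec_of \<A> c (chart_inv c x) v"
        using tangent_eq_tvec_of[OF mf at(1) \<xi>(1)] by metis
      show ?thesis using \<xi>(2) unfolding v pairing loc by blast
    qed
    show "\<exists>p. p \<bullet> v = H_loc \<A> c H t x p + L_loc \<A> c L t x v" for v
    proof -
      obtain \<alpha> where \<alpha>: "\<alpha> \<in> cotangent_space \<A> (chart_inv c x)"
        "\<alpha> (tvec_of \<A> c (chart_inv c x) v) =
          H t (chart_inv c x, \<alpha>) + L t (chart_inv c x, tvec_of \<A> c (chart_inv c x) v)"
        using legendre_dual_attained(1)[OF dual at(2) tv] by blast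
      obtain p where p: "\<alpha> = covec_of \<A> c (chart_inv c x) p"
        using cotangent_eq_covec_of[OF mf at(1) \<alpha>(1)] by blast
      show ?thesis using \<alpha>(2) unfolding p pairing loc by blast
    qed
    show "H_loc \<A> c H t x 0 + L_loc \<A> c L t x 0 \<le> K"
      using K[OF at(2)] unfolding loc zero_section[OF mf at(1)] .
  qed
qed

text \<open>This is where compactness of the manifold and periodicity in time enter. \<open>L\<close> inherits the
  periodicity from \<open>H\<close> because \<open>L\<close> is the fiberwise maximum of \<open>\<alpha> \<xi> - H\<close>.\<close>

lemma zero_section_sum_bounded:
  fixes \<A> :: "('a, 'n::finite) chart set"
  assumes mf: "Ck_manifold (Suc k) M \<A>" and "compact_space M"
    and H: "Ck_hamiltonian (Suc m) \<A> H" and L: "Ck_lagrangian (Suc m) \<A> L"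
    and dual: "fiberwise_legendre_dual M \<A> H L"
    and periodic: "\<forall>t. \<forall>z\<in>coTM M \<A>. H (t + 1) z = H t z"
  obtains K where "\<And>t q. q \<in> topspace M \<Longrightarrow> H t (q, \<lambda>_. 0) + L t (q, \<lambda>_. 0) \<le> K"
proof (rule periodic_continuous_bounded[OF mf assms(2)])
  fix c assume c: "c \<in> \<A>"
  let ?U = "snd c ` fst c"
  have at: "c \<in> charts_at \<A> (chart_inv c x)" if "x \<in> ?U" for x
    using chart_inv_mem[OF that] c by (simp add: charts_at_def)
  have "continuous_on (coord_domain c) (\<lambda>(t, x, p). H_loc \<A> c H t x p)"
    "continuous_on (coord_domain c) (\<lambda>(t, x, v). L_loc \<A> c L t x v)"
    using H L c unfolding Ck_hamiltonian_def Ck_lagrangian_def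
    by (auto intro!: continuous_at_imp_continuous_on differentiable_imp_continuous_within)
  then have "continuous_on (coord_domain c) (\<lambda>(t, x, p). H_loc \<A> c H t x p + L_loc \<A> c L t x p)"
    by (auto dest: continuous_on_add simp: case_prod_unfold)
  moreover have "continuous_on (UNIV \<times> ?U) (\<lambda>(t, x). (t, x, 0))"
    by (auto simp: case_prod_unfold intro!: continuous_intros)
  moreover have "(\<lambda>(t, x). (t, x, 0)) ` (UNIV \<times> ?U) \<subseteq> coord_domain c"
    by (auto simp: coord_domain_def)
  ultimately have "continuous_on (UNIV \<times> ?U)
      (\<lambda>y. (\<lambda>(t, x, p). H_loc \<A> c H t x p + L_loc \<A> c L t x p) ((\<lambda>(t, x). (t, x, 0)) y))"
    by (rule continuous_on_compose2)
  moreover have "(\<lambda>(t, x, p). H_loc \<A> c H t x p + L_loc \<A> c L t x p) ((\<lambda>(t, x). (t, x, 0)) y) =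
      (\<lambda>(t, x). H t (chart_inv c x, \<lambda>_. 0) + L t (chart_inv c x, \<lambda>_. 0)) y"
    if "y \<in> UNIV \<times> ?U" for y
    using that zero_section[OF mf at]
    by (auto simp: H_loc_def L_loc_def cotangent_param_def tangent_param_def)
  ultimately show "continuous_on (UNIV \<times> ?U)
      (\<lambda>(t, x). H t (chart_inv c x, \<lambda>_. 0) + L t (chart_inv c x, \<lambda>_. 0))"
    using continuous_on_cong[OF refl] by (metis (mono_tags, lifting))
next
  fix t :: real and q assume q: "q \<in> topspace M"
  note D = legendre_dual_attained[OF dual q]
  have "topspace M = (\<Union>c\<in>\<A>. fst c)" using mf unfolding Ck_manifold_def by blast
  with q obtain c where c: "c \<in> charts_at \<A> q" by (auto simp: charts_at_def)
  have zero: "(\<lambda>_. 0) \<in> tangent_space \<A> q" "(\<lambda>_. 0) \<in> cotangent_space \<A> q"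
    using tvec_of_mem[OF mf c, of 0] covec_of_mem[OF mf c, of 0] by (simp_all add: zero_section[OF mf c])
  have shift: "H (t + 1) (q, \<alpha>) = H t (q, \<alpha>)" if "\<alpha> \<in> cotangent_space \<A> q" for \<alpha>
    using periodic that q by (simp add: coTM_def)
  have "L (t + 1) (q, \<lambda>_. 0) = L t (q, \<lambda>_. 0)"
  proof (rule antisym)
    show "L (t + 1) (q, \<lambda>_. 0) \<le> L t (q, \<lambda>_. 0)"
      using D(1)[OF zero(1), of "t + 1"] D(3)[OF zero(1), of _ t] shift by fastforce
    show "L t (q, \<lambda>_. 0) \<le> L (t + 1) (q, \<lambda>_. 0)"
      using D(1)[OF zero(1), of t] D(3)[OF zero(1), of _ "t + 1"] shift by fastforce
  qed
  with shift[OF zero(2)] show "H (t + 1) (q, \<lambda>_. 0) + L (t + 1) (q, \<lambda>_. 0) =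
      H t (q, \<lambda>_. 0) + L t (q, \<lambda>_. 0)" by simp
qed (use that in blast)

text \<open>The bounds in either formulation survive an increase of the upper constant. This provides the strict
  inequality between the two constants and, given a threshold \<open>D\<close>, room for a further bound
  with constant \<open>D\<close>.\<close>

lemma cond_A_iff_fiber_bounds:
  fixes c :: "('a, 'n::finite) chart"
  defines "U \<equiv> snd c ` fst c"
  assumes "\<And>t. C2_fibered U (H_loc \<A> c H t)"
  shows "(\<exists>C1 C2. 0 < C1 \<and> C1 < C2 \<and> cond_A \<A> H c C1 C2 \<and> D \<le> C2) \<longleftrightarrow>
    (\<exists>C1 C2. 0 < C1 \<and> fiber_bounds U (H_loc \<A> c H) C1 C2)"
proof
  assume "\<exists>C1 C2. 0 < C1 \<and> fiber_bounds U (H_loc \<A> c H) C1 C2"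
  then obtain C1 C where C: "0 < C1" "fiber_bounds U (H_loc \<A> c H) C1 C" by blast
  let ?C2 = "max (max (C1 + 1) D) ((real CARD('n))\<^sup>2 * C)"
  have "cond_A \<A> H c C1 ?C2"
    by (rule cond_A_mono[OF fiber_bounds_imp_cond_A[OF C(2)[unfolded U_def]]]) simp
  then show "\<exists>C1 C2. 0 < C1 \<and> C1 < C2 \<and> cond_A \<A> H c C1 C2 \<and> D \<le> C2"
    using C(1) by (intro exI[of _ C1] exI[of _ ?C2]) auto
next
  assume "\<exists>C1 C2. 0 < C1 \<and> C1 < C2 \<and> cond_A \<A> H c C1 C2 \<and> D \<le> C2"
  then show "\<exists>C1 C2. 0 < C1 \<and> fiber_bounds U (H_loc \<A> c H) C1 C2"
    using cond_A_imp_fiber_bounds[OF assms(2)[unfolded U_def]] unfolding U_def by blast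
qed

lemma fiber_bounds_above:
  "(\<exists>c C. 0 < c \<and> c < C \<and> fiber_bounds U F c C \<and> D \<le> C) \<longleftrightarrow> (\<exists>c C. 0 < c \<and> fiber_bounds U F c C)"
proof
  assume "\<exists>c C. 0 < c \<and> fiber_bounds U F c C"
  then obtain c C where C: "0 < c" "fiber_bounds U F c C" by blast
  let ?C = "max (max (c + 1) D) C"
  have "fiber_bounds U F c ?C" by (rule fiber_bounds_mono[OF C(2)]) simp
  then show "\<exists>c C. 0 < c \<and> c < C \<and> fiber_bounds U F c C \<and> D \<le> C"
    using C(1) by (intro exI[of _ c] exI[of _ ?C]) auto
qed blast

section \<open>Equivalence of the conditions\<close>

theorem propositionA:
  fixes M :: "'a topology"
    and \<A> \<C> :: "('a, 'n::finite) chart set"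
    and H :: "('a, 'n) hamiltonian"
    and L :: "('a, 'n) lagrangian"
  assumes "Ck_manifold 3 M \<A>" and "connected_space M" and "compact_space M"
    and "Ck_hamiltonian 2 \<A> H" and "Ck_lagrangian 2 \<A> L"
    and "fiberwise_legendre_dual M \<A> H L"
    and "\<forall>t. \<forall>z\<in>coTM M \<A>. H (t + 1) z = H t z"
    and "\<C> \<subseteq> \<A>"
  shows "(holds_A \<A> \<C> H \<longleftrightarrow> holds_C_Dvv \<A> \<C> L) \<and> (holds_AB \<A> \<C> H \<longleftrightarrow> holds_CD \<A> \<C> L)"
proof -
  have mf: "Ck_manifold (Suc 2) M \<A>"
    and C1: "Ck_hamiltonian (Suc 1) \<A> H" "Ck_lagrangian (Suc 1) \<A> L"
    using assms(1,4,5) by (simp_all add: numeral_3_eq_3 numeral_2_eq_2)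
  obtain K where K: "\<And>t q. q \<in> topspace M \<Longrightarrow> H t (q, \<lambda>_. 0) + L t (q, \<lambda>_. 0) \<le> K"
    using zero_section_sum_bounded[OF mf assms(3) C1 assms(6,7)] by blast
  have chart:
    "(\<exists>C1 C2. 0 < C1 \<and> C1 < C2 \<and> cond_A \<A> H c C1 C2) \<longleftrightarrow>
     (\<exists>c0 C0. 0 < c0 \<and> c0 < C0 \<and> cond_C \<A> L c c0 \<and> cond_D_vv \<A> L c C0)" (is "?A \<longleftrightarrow> ?CDvv")
    "(\<exists>C1 C2. 0 < C1 \<and> C1 < C2 \<and> cond_A \<A> H c C1 C2 \<and> cond_B \<A> H c C2) \<longleftrightarrow>
     (\<exists>c0 C0. 0 < c0 \<and> c0 < C0 \<and>
        cond_C \<A> L c c0 \<and> cond_D_qq_qv \<A> L c C0 \<and> cond_D_vv \<A> L c C0)" (is "?AB \<longleftrightarrow> ?CD")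
    if "c \<in> \<C>" for c
  proof -
    let ?U = "snd c ` fst c"
    let ?F = "\<lambda>F. \<exists>c0 C0. 0 < c0 \<and> fiber_bounds ?U F c0 C0"
    let ?B = "\<lambda>F. \<exists>B. base_bounds ?U F B"
    let ?H = "H_loc \<A> c H" and ?L = "L_loc \<A> c L"
    have c: "c \<in> \<A>" using that assms(8) by blast
    note pair = fenchel_pair_local[OF mf assms(4-6) K c]
    note swap = fenchel_pair_swap[OF pair]
    have fibered: "C2_fibered ?U (?H t)" for t
      using pair[of t] unfolding fenchel_pair_def by blast
    note A = cond_A_iff_fiber_bounds[OF fibered]
    have HA: "?A \<longleftrightarrow> ?F ?H"
      using A by blast
    have HAB: "?AB \<longleftrightarrow> ?F ?H \<and> ?B ?H"
      using A base_bounds_mono unfolding base_bounds_iff_cond_B[symmetric] by blast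
    have LC: "?CDvv \<longleftrightarrow> ?F ?L"
      unfolding fiber_bounds_iff_cond_C_Dvv[symmetric] using fiber_bounds_above by blast
    have LCD: "?CD \<longleftrightarrow> ?F ?L \<and> ?B ?L"
      using fiber_bounds_above[of ?U ?L] base_bounds_mono
      unfolding base_bounds_iff_cond_D[symmetric] fiber_bounds_iff_cond_C_Dvv by blast
    have F: "?F ?H \<longleftrightarrow> ?F ?L"
    proof
      show "?F ?L" if "?F ?H"
        using that by (elim exE conjE) (rule fiber_bounds_dual[OF pair])
      show "?F ?H" if "?F ?L"
        using that by (elim exE conjE) (rule fiber_bounds_dual[OF swap])
    qed
    then have FB: "?F ?H \<and> ?B ?H \<longleftrightarrow> ?F ?L \<and> ?B ?L"
    proof (rule conj_cong[OF _ iffI])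
      show "?B ?L" if "?F ?L" "?B ?H"
        using F[THEN iffD2, OF that(1)] that(2)
        by (elim exE conjE) (rule base_bounds_dual[OF pair])
      show "?B ?H" if "?F ?L" "?B ?L"
        using that by (elim exE conjE) (rule base_bounds_dual[OF swap])
    qed
    show "?A \<longleftrightarrow> ?CDvv" unfolding HA LC by (rule F)
    show "?AB \<longleftrightarrow> ?CD" unfolding HAB LCD by (rule FB)
  qed
  show ?thesis
    unfolding holds_A_def holds_AB_def holds_C_Dvv_def holds_CD_def
    by (intro conjI ball_cong refl chart)
qed

end
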